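(* Let $\mathbb{K}$ be a field, $V=\mathbb{K}^\ell$, and let $\mathcal{A}\neq\Phi_\ell$ be a central hyperplane arrangement in $V$. Let $\pi=(\pi_1,\ldots,\pi_s)$ be a partition of $\mathcal{A}$, let $H_0\in\pi_1$, and let $(\mathcal{A},\mathcal{A}',\mathcal{A}'')$ be the triple associated with $H_0$. Suppose that the restriction map $\mathrm{R}:\mathcal{A}\setminus\pi_1\to\mathcal{A}''$, $H\mapsto H\cap H_0$, is bijective. Then any two of the following statements imply the third: (i) $\kappa:[\pi_1]\otimes\cdots\otimes[\pi_s]\to A(\mathcal{A})$ is an isomorphism of graded $\mathbb{K}$-vector spaces; (ii) $\kappa':[\pi_1']\otimes\cdots\otimes[\pi_s']\to A(\mathcal{A}')$ is an isomorphism of graded $\mathbb{K}$-vector spaces; (iii) $\kappa'':[\pi_2'']\otimes\cdots\otimes[\pi_s'']\to A(\mathcal{A}'')$ is an isomorphism of graded $\mathbb{K}$-vector spaces.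
   Context: A central arrangement $\mathcal{A}$ in $V=\mathbb{K}^\ell$ is a finite set of linear hyperplanes of $V$; $\Phi_\ell$ is the empty arrangement. For $H_0\in\mathcal{A}$ the associated triple is $\mathcal{A}'=\mathcal{A}\setminus\{H_0\}$ and $\mathcal{A}''=\{H_0\cap H\mid H\in\mathcal{A}'\}$, an arrangement in $H_0$. A partition $\pi=(\pi_1,\ldots,\pi_s)$ of $\mathcal{A}$ is an ordered tuple of non-empty pairwise disjoint subsets with union $\mathcal{A}$. Given $\pi$ and $H_0\in\pi_1$: the induced partition $\pi'$ of $\mathcal{A}'$ consists of the non-empty sets $\pi_i'=\pi_i\cap\mathcal{A}'$; and $\pi''=(\pi_2'',\ldots,\pi_s'')$ with $\pi_i''=\mathrm{R}(\pi_i)=\{H\cap H_0\mid H\in\pi_i\}$ (a partition of $\mathcal{A}''$ when $\mathrm{R}$ is bijective). The Orlik–Solomon algebra $A(\mathcal{B})$ of an arrangement $\mathcal{B}$ is the graded anticommutative $\mathbb{K}$-algebra $E/I$, where $E$ is the exterior algebra on degree-one generators $e_H$ ($H\in\mathcal{B}$) and $I$ is the ideal generated by $\partial(e_{H_1}\cdots e_{H_p})=\sum_k(-1)^{k-1}e_{H_1}\cdots\widehat{e_{H_k}}\cdots e_{H_p}$ for all linearly dependent tuples $(H_1,\ldots,H_p)$ (i.e. $\operatorname{codim}(H_1\cap\cdots\cap H_p)<p$); $a_H$ denotes the image of $e_H$. For a subset $\sigma$ of $\mathcal{B}$ put $[\sigma]=\mathbb{K}+\sum_{H\in\sigma}\mathbb{K}a_H\subseteq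 A(\mathcal{B})$ (graded, with $1$ in degree $0$ and $a_H$ in degree $1$), and for a partition $(\sigma_1,\ldots,\sigma_t)$ of $\mathcal{B}$, $\kappa:[\sigma_1]\otimes\cdots\otimes[\sigma_t]\to A(\mathcal{B})$ is the $\mathbb{K}$-linear map induced by multiplication; $\kappa,\kappa',\kappa''$ are these maps for $\pi,\pi',\pi''$ (with $[\varnothing]=\mathbb{K}$ for the empty arrangement). *)

theory Defs
  imports "HOL-Analysis.Analysis"
begin

definition lin_hyperplane :: "('k::field ^ 'n) set \<Rightarrow> bool" where
  "lin_hyperplane H \<longleftrightarrow> (\<exists>a. a \<noteq> 0 \<and> H = {x. (\<Sum>i\<in>UNIV. a $ i * x $ i) = 0})"

definition central_arrangement :: "('k::field ^ 'n) set set \<Rightarrow> bool" where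
  "central_arrangement A \<longleftrightarrow> finite A \<and> (\<forall>H\<in>A. lin_hyperplane H)"

text \<open>Linear dependence of a tuple (H_1,...,H_p) of hyperplanes of an arrangement living in
  the ambient subspace W: codim_W (H_1 \<inter> ... \<inter> H_p) < p, where the empty intersection is W.\<close>
definition lin_dependent :: "('k::field ^ 'n) set \<Rightarrow> ('k ^ 'n) set list \<Rightarrow> bool" where
  "lin_dependent W hs \<longleftrightarrow>
     vec.dim W - vec.dim (W \<inter> \<Inter>(set hs)) < length hs"

text \<open>Elements of the free associative K-algebra on generators of type 'h are represented as
  coefficient functions on words ('h list). The exterior algebra E is the quotient of it by the
  ideal generated by e_H e_H and e_H e_K + e_K e_H, so A(B) = T/(J_ext + J_OS).\<close>

definition word :: "'h list \<Rightarrow> 'h list \<Rightarrow> 'k::field" where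
  "word u = (\<lambda>w. if w = u then 1 else 0)"

definition lmul :: "'h list \<Rightarrow> ('h list \<Rightarrow> 'k::field) \<Rightarrow> 'h list \<Rightarrow> 'k" where
  "lmul u f = (\<lambda>w. if take (length u) w = u then f (drop (length u) w) else 0)"

definition rmul :: "('h list \<Rightarrow> 'k::field) \<Rightarrow> 'h list \<Rightarrow> 'h list \<Rightarrow> 'k" where
  "rmul f v = (\<lambda>w. if length v \<le> length w \<and> drop (length w - length v) w = v
                     then f (take (length w - length v) w) else 0)"

definition fspan :: "('h list \<Rightarrow> 'k::field) set \<Rightarrow> ('h list \<Rightarrow> 'k) set" where
  "fspan S = {x. \<exists>F c. finite F \<and> F \<subseteq> S \<and> x = (\<lambda>w. \<Sum>f\<in>F. c f * f w)}"

definition bdry :: "'h list \<Rightarrow> 'h list \<Rightarrow> 'k::field" where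
  "bdry hs = (\<lambda>w. \<Sum>k<length hs. (-1) ^ k * word (take k hs @ drop (Suc k) hs) w)"

definition OS_relations :: "('h list \<Rightarrow> bool) \<Rightarrow> 'h set \<Rightarrow> ('h list \<Rightarrow> 'k::field) set" where
  "OS_relations dep B =
     {word [H, H] | H. H \<in> B}
   \<union> {(\<lambda>w. word [H, K] w + word [K, H] w) | H K. H \<in> B \<and> K \<in> B}
   \<union> {bdry hs | hs. hs \<in> lists B \<and> dep hs}"

definition OS_ideal_gens :: "('h list \<Rightarrow> bool) \<Rightarrow> 'h set \<Rightarrow> ('h list \<Rightarrow> 'k::field) set" where
  "OS_ideal_gens dep B =
     {lmul u (rmul r v) | u v r. u \<in> lists B \<and> v \<in> lists B \<and> r \<in> OS_relations dep B}"

text \<open>Basis of [sigma_1] \<otimes> ... \<otimes> [sigma_t]: tensors of basis elements, i.e. choices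
  ch with ch i = None (the element 1 of [sigma_i]) or ch i = Some H with H in sigma_i
  (the element a_H), for i < t.\<close>
definition choices :: "'h set list \<Rightarrow> (nat \<Rightarrow> 'h option) set" where
  "choices \<sigma> = {ch. (\<forall>i<length \<sigma>. ch i = None \<or> (\<exists>H\<in>\<sigma> ! i. ch i = Some H))
                   \<and> (\<forall>i\<ge>length \<sigma>. ch i = None)}"

text \<open>kappa maps the basis tensor ch to the product of the chosen a_H in block order.\<close>
definition choice_word :: "nat \<Rightarrow> (nat \<Rightarrow> 'h option) \<Rightarrow> 'h list" where
  "choice_word t ch = concat (map (\<lambda>i. case ch i of None \<Rightarrow> [] | Some H \<Rightarrow> [H]) [0..<t])"

text \<open>kappa is an isomorphism of graded vector spaces (it is degree preserving by
  construction, so this means: the images of the basis tensors form a basis of A(B),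
  i.e. they span A(B) and are linearly independent modulo the defining ideal).\<close>
definition kappa_iso :: "('h list \<Rightarrow> bool) \<Rightarrow> 'h set \<Rightarrow> 'h set list \<Rightarrow> 'k::field itself \<Rightarrow> bool" where
  "kappa_iso dep B \<sigma> _ \<longleftrightarrow>
     (\<forall>w\<in>lists B. (word w :: 'h list \<Rightarrow> 'k) \<in>
         fspan ((\<lambda>ch. word (choice_word (length \<sigma>) ch)) ` choices \<sigma> \<union> OS_ideal_gens dep B))
   \<and> (\<forall>c :: (nat \<Rightarrow> 'h option) \<Rightarrow> 'k.
        (\<lambda>w. \<Sum>ch\<in>choices \<sigma>. c ch * word (choice_word (length \<sigma>) ch) w) \<in> fspan (OS_ideal_gens dep B)
        \<longrightarrow> (\<forall>ch\<in>choices \<sigma>. c ch = 0))"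

definition is_partition :: "'h set \<Rightarrow> 'h set list \<Rightarrow> bool" where
  "is_partition B \<pi> \<longleftrightarrow>
     (\<forall>i<length \<pi>. \<pi> ! i \<noteq> {})
   \<and> (\<forall>i<length \<pi>. \<forall>j<length \<pi>. i \<noteq> j \<longrightarrow> \<pi> ! i \<inter> \<pi> ! j = {})
   \<and> \<Union>(set \<pi>) = B"

definition restr_arr :: "('k::field ^ 'n) set set \<Rightarrow> ('k ^ 'n) set \<Rightarrow> ('k ^ 'n) set set" where
  "restr_arr A H0 = (\<lambda>H. H0 \<inter> H) ` (A - {H0})"

definition deletion_partition :: "'h set list \<Rightarrow> 'h \<Rightarrow> 'h set list" where
  "deletion_partition \<pi> H0 = filter (\<lambda>X. X \<noteq> {}) (map (\<lambda>X. X - {H0}) \<pi>)"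

definition restriction_partition ::
  "('k::field ^ 'n) set set list \<Rightarrow> ('k ^ 'n) set \<Rightarrow> ('k ^ 'n) set set list" where
  "restriction_partition \<pi> H0 = map (\<lambda>X. (\<lambda>H. H \<inter> H0) ` X) (tl \<pi>)"

end

theory Submission
  imports Defs "HOL-Library.Function_Algebras"
begin

text \<open>
  Write \<open>\<partial>\<close> for the derivation with \<open>\<partial>e\<^sub>H = 1\<close>, and \<open>T, T', T''\<close> for the free algebras on
  \<open>\<A>, \<A>', \<A>''\<close>. The ideal \<open>I\<close> of relations in \<open>T\<close> is the largest \<open>\<partial>\<close>-stable subspace without
  constants that is graded by length and by the flat \<open>\<Inter>H\<^sub>i\<close>: if \<open>q\<close> is homogeneous of length at
  least the rank of its flat (no other lengths occur) and \<open>h\<close> is a letter of \<open>q\<close>,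
  then \<open>e\<^sub>h q\<close> is a combination of dependent words, hence in \<open>I\<close>, and \<open>q = \<partial>(e\<^sub>h q) + e\<^sub>h \<partial>q\<close>, so one
  concludes by induction on the length. Applied in \<open>T'\<close> to \<open>I \<inter> T'\<close> this shows that \<open>A(\<A>')\<close> embeds in \<open>A(\<A>)\<close>;
  applied to the image in \<open>T''\<close> of all \<open>q\<close> with \<open>e\<^bsub>H0\<^esub> q \<in> T' + I\<close> it gives exactness of
  \<open>0 \<rightarrow> A(\<A>') \<rightarrow> A(\<A>) \<rightarrow> A(\<A>'') \<rightarrow> 0\<close> in the middle. Bijectivity of \<open>R\<close> turns the products for \<open>\<pi>\<close> into
  those for \<open>\<pi>'\<close> together with \<open>e\<^bsub>H0\<^esub>\<close> times lifts of those for \<open>\<pi>''\<close>, and the five lemma applies.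
\<close>

section \<open>The free algebra\<close>

text \<open>With pointwise addition this turns functions on words into a vector space, so that
  spans, subspaces and linear maps are those of the locale \<open>vector_space\<close>.\<close>

definition fscale :: "'k::field \<Rightarrow> ('a \<Rightarrow> 'k) \<Rightarrow> 'a \<Rightarrow> 'k" where
  "fscale c f = (\<lambda>x. c * f x)"

lemma fscale_apply: "fscale c f x = c * f x"
  by (simp add: fscale_def)

lemma sum_fun_apply: "(\<Sum>i\<in>I. f i) x = (\<Sum>i\<in>I. f i x)"
  by (induction I rule: infinite_finite_induct) (auto simp: plus_fun_apply zero_fun_apply)

text \<open>As simp rules these would unfold sums of functions before linearity can be used.\<close>

declare plus_fun_apply [simp del] zero_fun_apply [simp del] minus_apply [simp del]
  uminus_apply [simp del]

lemmas pointwise = fun_eq_iff plus_fun_apply zero_fun_apply minus_apply uminus_apply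
  fscale_apply sum_fun_apply

interpretation fs: vector_space "fscale :: 'k::field \<Rightarrow> ('a \<Rightarrow> 'k) \<Rightarrow> _"
  by unfold_locales (auto simp: pointwise algebra_simps)

interpretation fsp: vector_space_pair
  "fscale :: 'k::field \<Rightarrow> ('a \<Rightarrow> 'k) \<Rightarrow> _" "fscale :: 'k::field \<Rightarrow> ('b \<Rightarrow> 'k) \<Rightarrow> _"
  by unfold_locales

abbreviation flinear :: "(('a \<Rightarrow> 'k::field) \<Rightarrow> 'b \<Rightarrow> 'k) \<Rightarrow> bool" where
  "flinear \<equiv> Vector_Spaces.linear fscale fscale"

lemma flinearI:
  assumes "\<And>f g. F (f + g) = F f + F g" "\<And>c f. F (fscale c f) = fscale c (F f)"
  shows "flinear F"
  using assms by (simp add: Vector_Spaces.linear_iff fs.vector_space_axioms)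

lemma fspan_eq_span: "fspan S = fs.span S"
  unfolding fspan_def fs.span_explicit by (auto simp: pointwise)

lemma linear_span_into:
  assumes "flinear F" "fs.subspace T" "\<And>x. x \<in> S \<Longrightarrow> F x \<in> T" "x \<in> fs.span S"
  shows "F x \<in> T"
proof -
  have "fs.span S \<subseteq> F -` T"
    using assms(1-3) by (intro fs.span_minimal fsp.linear_subspace_vimage) auto
  then show ?thesis using assms(4) by auto
qed

text \<open>The free algebra on \<open>B\<close> is \<open>wspan (lists B)\<close>. The type also
  contains functions of infinite support, so membership is carried along as a hypothesis.\<close>

definition wspan :: "'h list set \<Rightarrow> ('h list \<Rightarrow> 'k::field) set" where
  "wspan L = fs.span (word ` L)"

lemma word_apply: "word u w = (if w = u then 1 else 0)"
  by (simp add: word_def)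

lemma word_eq_iff [simp]: "(word u :: 'h list \<Rightarrow> 'k::field) = word v \<longleftrightarrow> u = v"
  by (auto simp: word_def fun_eq_iff)

lemma subspace_wspan [intro, simp]: "fs.subspace (wspan L)"
  by (simp add: wspan_def)

lemma word_in_wspan [intro, simp]: "w \<in> L \<Longrightarrow> word w \<in> wspan L"
  by (simp add: wspan_def fs.span_base)

lemma wspan_mono: "L \<subseteq> L' \<Longrightarrow> wspan L \<subseteq> wspan L'"
  unfolding wspan_def by (intro fs.span_mono image_mono)

lemma wspan_expand:
  assumes "finite {w. f w \<noteq> 0}"
  shows "f = (\<Sum>w | f w \<noteq> 0. fscale (f w) (word w))"
  using assms by (auto simp: pointwise word_apply if_distrib cong: if_cong)

lemma wspan_iff: "f \<in> wspan L \<longleftrightarrow> finite {w. f w \<noteq> 0} \<and> {w. f w \<noteq> 0} \<subseteq> L"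
proof
  assume "f \<in> wspan L"
  then show "finite {w. f w \<noteq> 0} \<and> {w. f w \<noteq> 0} \<subseteq> L"
    unfolding wspan_def
  proof (induction rule: fs.span_induct_alt)
    case (step c x y)
    have "{w. (fscale c x + y) w \<noteq> 0} \<subseteq> {w. x w \<noteq> 0} \<union> {w. y w \<noteq> 0}"
      by (auto simp: pointwise)
    moreover have "finite {w. x w \<noteq> 0}" "{w. x w \<noteq> 0} \<subseteq> L"
      using step by (auto simp: word_apply split: if_splits)
    ultimately show ?case using step by (meson finite_UnI finite_subset le_supI subset_trans)
  qed (auto simp: pointwise)
next
  assume "finite {w. f w \<noteq> 0} \<and> {w. f w \<noteq> 0} \<subseteq> L"
  then show "f \<in> wspan L"
    using wspan_expand[of f]
    by (metis (mono_tags, lifting) fs.subspace_scale fs.subspace_sum subsetD subspace_wspan word_in_wspan)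
qed

text \<open>The support of \<open>word w\<close> is \<open>{w}\<close>, which no combination of
  other words can have. Hence linear maps may be prescribed freely on words.\<close>

lemma independent_word: "fs.independent (range (word :: 'h list \<Rightarrow> 'h list \<Rightarrow> 'k::field))"
proof -
  have "(word w :: 'h list \<Rightarrow> 'k) \<notin> fs.span (range word - {word w})" for w
  proof
    assume "(word w :: 'h list \<Rightarrow> 'k) \<in> fs.span (range word - {word w})"
    moreover have "range word - {word w} = (word ` (UNIV - {w}) :: ('h list \<Rightarrow> 'k) set)" by auto
    ultimately have "(word w :: 'h list \<Rightarrow> 'k) \<in> wspan (UNIV - {w})" by (simp add: wspan_def)
    then show False by (auto simp: wspan_iff word_apply split: if_splits)
  qed
  then show ?thesis by (auto simp: fs.dependent_def)
qed

text \<open>The values outside the span of the words are arbitrary.\<close>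

definition lin_ext :: "('h list \<Rightarrow> 'a \<Rightarrow> 'k::field) \<Rightarrow> ('h list \<Rightarrow> 'k) \<Rightarrow> 'a \<Rightarrow> 'k" where
  "lin_ext g = fsp.construct (range word) (g \<circ> the_inv word)"

lemma linear_lin_ext [intro, simp]: "flinear (lin_ext g)"
  unfolding lin_ext_def by (intro fsp.linear_construct independent_word)

lemma lin_ext_word [simp]: "lin_ext g (word u) = g u"
  unfolding lin_ext_def
  by (subst fsp.construct_basis[OF independent_word])
     (auto simp: inj_def intro!: arg_cong[of _ _ g] the_inv_f_f)

text \<open>The main device for identities in the free algebra: both sides are linear in the
  element, so words suffice.\<close>

lemma linear_eq_on_wspan:
  assumes "flinear F" "flinear G" "\<And>w. w \<in> L \<Longrightarrow> F (word w) = G (word w)" "f \<in> wspan L"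
  shows "F f = G f"
  using fsp.linear_eq_on[OF assms(1,2), of f "word ` L"] assms(3,4) by (auto simp: wspan_def)

lemma linear_wspan_into:
  assumes "flinear F" "fs.subspace T" "\<And>w. w \<in> L \<Longrightarrow> F (word w) \<in> T" "f \<in> wspan L"
  shows "F f \<in> T"
  using linear_span_into[OF assms(1,2), of "word ` L"] assms(3,4) by (auto simp: wspan_def)

text \<open>When \<open>P\<close> fixes the length or the flat of a word, this is the projection
  onto a homogeneous component.\<close>

definition restr :: "('a \<Rightarrow> bool) \<Rightarrow> ('a \<Rightarrow> 'k::field) \<Rightarrow> 'a \<Rightarrow> 'k" where
  "restr P f = (\<lambda>w. if P w then f w else 0)"

lemma linear_restr [intro, simp]: "flinear (restr P)"
  by (rule flinearI) (auto simp: restr_def pointwise)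

lemma restr_word [simp]: "restr P (word w) = (if P w then word w else 0)"
  by (auto simp: restr_def word_apply pointwise)

section \<open>Left and right multiplication by words\<close>

lemma linear_lmul [intro, simp]: "flinear (lmul u)"
  by (rule flinearI) (auto simp: lmul_def pointwise)

lemma linear_rmul [intro, simp]: "flinear (\<lambda>f. rmul f v)"
  by (rule flinearI) (auto simp: rmul_def pointwise)

lemmas lmul_add = fsp.linear_add[OF linear_lmul]
lemmas lmul_diff = fsp.linear_diff[OF linear_lmul]
lemmas rmul_add = fsp.linear_add[OF linear_rmul]
lemmas rmul_diff = fsp.linear_diff[OF linear_rmul]
lemmas lmul_scale = fsp.linear_scale[OF linear_lmul]
lemmas rmul_scale = fsp.linear_scale[OF linear_rmul]
lemmas lmul_0 [simp] = fsp.linear_0[OF linear_lmul]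
lemmas rmul_0 [simp] = fsp.linear_0[OF linear_rmul]

lemma lmul_word [simp]: "lmul u (word w) = word (u @ w)"
  by (auto simp: lmul_def word_apply pointwise append_eq_conv_conj) (metis append_take_drop_id)

lemma rmul_word [simp]: "rmul (word w) v = word (w @ v)"
  by (auto simp: rmul_def word_apply pointwise) (metis append_take_drop_id)

lemma lmul_Nil [simp]: "lmul [] f = f"
  by (simp add: lmul_def)

lemma rmul_Nil [simp]: "rmul f [] = f"
  by (simp add: rmul_def)

lemma lmul_append: "lmul u f (u @ w) = f w"
  by (simp add: lmul_def)

lemma rmul_append: "rmul f v (w @ v) = f w"
  by (simp add: rmul_def)

lemma lmul_eq_0: "\<nexists>x. w = u @ x \<Longrightarrow> lmul u f w = 0"
  by (auto simp: lmul_def) (metis append_take_drop_id)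

lemma rmul_eq_0: "\<nexists>x. w = x @ v \<Longrightarrow> rmul f v w = 0"
  by (auto simp: rmul_def) (metis append_take_drop_id)

text \<open>No finite support is assumed, so values are compared word by word according to the
  prefix, not by linearity.\<close>

lemma lmul_lmul: "lmul u (lmul v f) = lmul (u @ v) f"
proof
  fix w
  show "lmul u (lmul v f) w = lmul (u @ v) f w"
  proof (cases "\<exists>x. w = u @ v @ x")
    case True
    then obtain x where x: "w = u @ v @ x" by blast
    then show ?thesis using lmul_append[of "u @ v" f x] by (simp add: lmul_append)
  next
    case False
    have "lmul u (lmul v f) w = 0"
      by (cases "\<exists>y. w = u @ y") (use False in \<open>auto simp: lmul_append lmul_eq_0\<close>)
    then show ?thesis using False by (simp add: lmul_eq_0)
  qed
qed

lemma rmul_rmul: "rmul (rmul f u) v = rmul f (u @ v)"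
proof
  fix w
  show "rmul (rmul f u) v w = rmul f (u @ v) w"
  proof (cases "\<exists>x. w = x @ u @ v")
    case True
    then obtain x where x: "w = x @ u @ v" by blast
    have "rmul (rmul f u) v ((x @ u) @ v) = f x" by (simp only: rmul_append)
    then show ?thesis using rmul_append[of f "u @ v" x] x by simp
  next
    case False
    have "rmul (rmul f u) v w = 0"
      by (cases "\<exists>y. w = y @ v") (use False in \<open>auto simp: rmul_append rmul_eq_0\<close>)
    then show ?thesis using False by (simp add: rmul_eq_0)
  qed
qed

lemma lmul_rmul: "lmul u (rmul f v) = rmul (lmul u f) v"
proof
  fix w
  show "lmul u (rmul f v) w = rmul (lmul u f) v w"
  proof (cases "\<exists>x. w = u @ x @ v")
    case True
    then obtain x where x: "w = u @ x @ v" by blast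
    have "rmul (lmul u f) v ((u @ x) @ v) = f x" by (simp only: rmul_append lmul_append)
    then show ?thesis using x by (simp add: rmul_append lmul_append)
  next
    case False
    have "lmul u (rmul f v) w = 0"
      by (cases "\<exists>y. w = u @ y") (use False in \<open>auto simp: lmul_append rmul_eq_0 lmul_eq_0\<close>)
    moreover have "rmul (lmul u f) v w = 0"
      by (cases "\<exists>y. w = y @ v") (use False in \<open>auto simp: rmul_append rmul_eq_0 lmul_eq_0\<close>)
    ultimately show ?thesis by simp
  qed
qed

lemma lmul_wspan: "u \<in> lists B \<Longrightarrow> f \<in> wspan (lists B) \<Longrightarrow> lmul u f \<in> wspan (lists B)"
  by (rule linear_wspan_into[where F = "lmul u" and L = "lists B"]) auto

lemma rmul_wspan: "v \<in> lists B \<Longrightarrow> f \<in> wspan (lists B) \<Longrightarrow> rmul f v \<in> wspan (lists B)"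
  by (rule linear_wspan_into[where F = "\<lambda>f. rmul f v" and L = "lists B"]) auto

section \<open>The derivation\<close>

text \<open>The antiderivation of degree -1 with value 1 on every generator, taken already on the
  free algebra.\<close>

definition der :: "('h list \<Rightarrow> 'k::field) \<Rightarrow> 'h list \<Rightarrow> 'k" where
  "der = lin_ext bdry"

lemma linear_der [intro, simp]: "flinear der"
  by (simp add: der_def)

lemmas der_add = fsp.linear_add[OF linear_der]
lemmas der_diff = fsp.linear_diff[OF linear_der]
lemmas der_scale = fsp.linear_scale[OF linear_der]
lemmas der_0 [simp] = fsp.linear_0[OF linear_der]

lemma der_word [simp]: "der (word w) = bdry w"
  by (simp add: der_def)

lemma bdry_alt: "bdry hs = (\<Sum>k<length hs. fscale ((-1) ^ k) (word (take k hs @ drop (Suc k) hs)))"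
  by (simp add: bdry_def pointwise)

lemma bdry_Nil [simp]: "bdry [] = 0"
  by (simp add: bdry_alt)

text \<open>The term \<open>k = 0\<close> deletes the head. All others keep it, and the index shift
  by one flips their sign.\<close>

lemma bdry_Cons: "bdry (h # w) = word w - lmul [h] (bdry w)"
  by (simp add: bdry_alt sum.lessThan_Suc_shift fsp.linear_sum[OF linear_lmul] lmul_scale
      del: sum.lessThan_Suc)
     (simp add: pointwise sum_negf)

lemma bdry_in_wspan: "bdry w \<in> wspan {v. set v \<subseteq> set w \<and> Suc (length v) = length w}"
  unfolding bdry_alt
  by (intro fs.subspace_sum fs.subspace_scale word_in_wspan subspace_wspan)
     (auto dest: in_set_takeD in_set_dropD)

lemma bdry_wspan: "w \<in> lists B \<Longrightarrow> bdry w \<in> wspan (lists B)"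
  by (rule subsetD[OF wspan_mono bdry_in_wspan]) auto

lemma bdry_wspan_UNIV [simp]: "bdry w \<in> wspan UNIV"
  using bdry_wspan[of w UNIV] by simp

lemma der_wspan: "f \<in> wspan (lists B) \<Longrightarrow> der f \<in> wspan (lists B)"
  by (rule linear_wspan_into[where F = der and L = "lists B"]) (auto intro: bdry_wspan)

lemma linear_compose: "flinear F \<Longrightarrow> flinear G \<Longrightarrow> flinear (\<lambda>x. F (G x))"
  by (rule flinearI) (simp_all add: fsp.linear_add fsp.linear_scale)

lemma linear_minus: "flinear F \<Longrightarrow> flinear G \<Longrightarrow> flinear (\<lambda>x. F x - G x)"
  by (rule flinearI) (simp_all add: fsp.linear_add fsp.linear_scale pointwise algebra_simps)

lemma linear_plus: "flinear F \<Longrightarrow> flinear G \<Longrightarrow> flinear (\<lambda>x. F x + G x)"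
  by (rule flinearI) (simp_all add: fsp.linear_add fsp.linear_scale pointwise algebra_simps)

lemma linear_id: "flinear (\<lambda>x. x)"
  by (rule flinearI) simp_all

text \<open>Leibniz rule for a letter on the left. Solved for \<open>f\<close>, it is the
  contracting homotopy on which the membership criterion for the ideal rests.\<close>

lemma der_lmul:
  assumes "f \<in> wspan UNIV"
  shows "der (lmul [h] f) = f - lmul [h] (der f)"
  by (rule linear_eq_on_wspan[OF linear_compose[OF linear_der linear_lmul]
        linear_minus[OF linear_id linear_compose[OF linear_lmul linear_der]] _ assms])
     (simp add: bdry_Cons)

lemma der_bdry: "der (bdry w) = 0"
proof (induction w)
  case (Cons h w)
  show ?case by (simp add: bdry_Cons der_diff der_lmul Cons.IH)
qed simp

text \<open>The sign that \<open>der\<close> picks up when it passes an element on its way to a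
  letter on the right, defined degree by degree so that it applies to inhomogeneous
  elements.\<close>

definition sgn_twist :: "('h list \<Rightarrow> 'k::field) \<Rightarrow> 'h list \<Rightarrow> 'k" where
  "sgn_twist f = (\<lambda>w. (-1) ^ length w * f w)"

lemma linear_sgn_twist [intro, simp]: "flinear sgn_twist"
  by (rule flinearI) (simp_all add: sgn_twist_def pointwise algebra_simps)

lemma sgn_twist_word: "sgn_twist (word w) = fscale ((-1) ^ length w) (word w)"
  by (auto simp: sgn_twist_def pointwise word_apply)

lemma bdry_snoc: "bdry (w @ [h]) = rmul (bdry w) [h] + sgn_twist (word w)"
proof (induction w)
  case Nil
  show ?case by (simp add: bdry_Cons sgn_twist_word)
next
  case (Cons a w)
  then show ?case
    by (simp add: bdry_Cons lmul_add lmul_rmul rmul_diff sgn_twist_word lmul_scale)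
qed

lemma der_rmul:
  assumes "f \<in> wspan UNIV"
  shows "der (rmul f [h]) = rmul (der f) [h] + sgn_twist f"
  by (rule linear_eq_on_wspan[OF linear_compose[OF linear_der linear_rmul]
        linear_plus[OF linear_compose[OF linear_rmul linear_der] linear_sgn_twist] _ assms])
     (simp add: bdry_snoc)

section \<open>The defining ideal\<close>

text \<open>The generators already carry words on both sides, so their linear span is the two-sided
  ideal of the free algebra on \<open>B\<close>.\<close>

definition OS_ideal :: "('h list \<Rightarrow> bool) \<Rightarrow> 'h set \<Rightarrow> ('h list \<Rightarrow> 'k::field) set" where
  "OS_ideal dep B = fs.span (OS_ideal_gens dep B)"

lemma subspace_OS_ideal [intro, simp]: "fs.subspace (OS_ideal dep B)"
  by (simp add: OS_ideal_def)

lemma OS_relationsE: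
  assumes "r \<in> OS_relations dep B"
  obtains (square) H where "H \<in> B" "r = word [H, H]"
  | (anti) H K where "H \<in> B" "K \<in> B" "r = word [H, K] + word [K, H]"
  | (bdry) hs where "hs \<in> lists B" "dep hs" "r = bdry hs"
  using assms unfolding OS_relations_def by (auto simp: plus_fun_def)

lemma square_relation: "H \<in> B \<Longrightarrow> word [H, H] \<in> OS_relations dep B"
  and anti_relation: "H \<in> B \<Longrightarrow> K \<in> B \<Longrightarrow> word [H, K] + word [K, H] \<in> OS_relations dep B"
  and bdry_relation: "hs \<in> lists B \<Longrightarrow> dep hs \<Longrightarrow> bdry hs \<in> OS_relations dep B"
  by (auto simp: OS_relations_def plus_fun_def)

lemma relation_wspan: "r \<in> OS_relations dep B \<Longrightarrow> r \<in> wspan (lists B)"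
  by (erule OS_relationsE) (auto intro!: bdry_wspan fs.subspace_add)

lemma relation_homogeneous:
  assumes "r \<in> OS_relations dep B"
  obtains n where "r \<in> wspan {w. length w = n}"
  using assms
proof (cases rule: OS_relationsE)
  case (bdry hs)
  \<comment> \<open>For empty \<open>hs\<close> the truncated subtraction is harmless, since
    \<open>bdry []\<close> is 0.\<close>
  have "bdry hs \<in> wspan {w. length w = length hs - 1}"
    by (rule subsetD[OF wspan_mono bdry_in_wspan]) auto
  then show ?thesis using bdry that by blast
qed (auto intro!: fs.subspace_add that[of 2])

text \<open>On a square the two terms cancel, on an anticommutator the four do, and boundaries have
  boundary 0. Only the multipliers remain to be treated when the ideal is shown to be
  stable.\<close>

lemma der_relation: "r \<in> OS_relations dep B \<Longrightarrow> der r = 0"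
  by (erule OS_relationsE) (simp_all add: bdry_Cons der_add der_bdry)

lemma gen_in_ideal:
  "r \<in> OS_relations dep B \<Longrightarrow> u \<in> lists B \<Longrightarrow> v \<in> lists B \<Longrightarrow> lmul u (rmul r v) \<in> OS_ideal dep B"
  unfolding OS_ideal_def OS_ideal_gens_def by (rule fs.span_base) blast

lemma relation_in_ideal: "r \<in> OS_relations dep B \<Longrightarrow> r \<in> OS_ideal dep B"
  using gen_in_ideal[of r dep B "[]" "[]"] by simp

lemma linear_ideal_into:
  fixes F :: "('h list \<Rightarrow> 'k::field) \<Rightarrow> 'b \<Rightarrow> 'k"
  assumes "flinear F" "fs.subspace T"
    "\<And>u v r. u \<in> lists B \<Longrightarrow> v \<in> lists B \<Longrightarrow> r \<in> OS_relations dep B \<Longrightarrow> F (lmul u (rmul r v)) \<in> T"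
    "f \<in> OS_ideal dep B"
  shows "F f \<in> T"
proof (rule linear_span_into[OF assms(1,2) _ assms(4)[unfolded OS_ideal_def]])
  fix x :: "'h list \<Rightarrow> 'k" assume "x \<in> OS_ideal_gens dep B"
  then show "F x \<in> T" using assms(3) by (auto simp: OS_ideal_gens_def)
qed

lemma ideal_subset_wspan: "OS_ideal dep B \<subseteq> wspan (lists B)"
proof
  fix f assume "f \<in> OS_ideal dep B"
  then show "f \<in> wspan (lists B)"
    by (rule linear_ideal_into[OF linear_id, rotated 2]) (auto intro!: lmul_wspan rmul_wspan intro: relation_wspan)
qed

lemma lmul_ideal:
  assumes "u \<in> lists B" "f \<in> OS_ideal dep B"
  shows "lmul u f \<in> OS_ideal dep B"
proof (rule linear_ideal_into[OF linear_lmul subspace_OS_ideal _ assms(2)])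
  fix u' v r assume "u' \<in> lists B" "v \<in> lists B" "r \<in> OS_relations dep B"
  then show "lmul u (lmul u' (rmul r v)) \<in> OS_ideal dep B"
    using assms(1) by (auto simp: lmul_lmul intro!: gen_in_ideal)
qed

lemma rmul_ideal:
  assumes "v \<in> lists B" "f \<in> OS_ideal dep B"
  shows "rmul f v \<in> OS_ideal dep B"
proof (rule linear_ideal_into[OF linear_rmul subspace_OS_ideal _ assms(2)])
  fix u v' r assume "u \<in> lists B" "v' \<in> lists B" "r \<in> OS_relations dep B"
  then show "rmul (lmul u (rmul r v')) v \<in> OS_ideal dep B"
    using assms(1) by (auto simp: lmul_rmul[symmetric] rmul_rmul intro!: gen_in_ideal)
qed

lemma relations_mono:
  assumes "B' \<subseteq> B" "r \<in> OS_relations dep B'"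
  shows "r \<in> OS_relations dep B"
  using assms(2) by (cases rule: OS_relationsE)
    (use assms(1) in \<open>auto intro!: square_relation anti_relation bdry_relation\<close>)

lemma ideal_mono:
  assumes "B' \<subseteq> B"
  shows "OS_ideal dep B' \<subseteq> OS_ideal dep B"
proof
  fix f assume "f \<in> OS_ideal dep B'"
  then show "f \<in> OS_ideal dep B"
    by (rule linear_ideal_into[OF linear_id, rotated 2])
       (use assms in \<open>auto intro!: gen_in_ideal relations_mono[OF assms]\<close>)
qed

lemma gen_homogeneous:
  assumes "r \<in> OS_relations dep B"
  obtains n where "lmul u (rmul r v) \<in> wspan {w. length w = n}"
proof -
  obtain m where m: "r \<in> wspan {w. length w = m}"
    using relation_homogeneous[OF assms] .
  have "lmul u (rmul r v) \<in> wspan {w. length w = length u + m + length v}"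
    by (rule linear_wspan_into[OF linear_compose[OF linear_lmul linear_rmul] _ _ m]) auto
  then show ?thesis by (rule that)
qed

lemma restr_wspan_cases:
  assumes "f \<in> wspan {w. key w = a}"
  shows "restr (\<lambda>w. key w = b) f = (if a = b then f else 0)"
  using assms by (auto simp: wspan_iff restr_def pointwise)

text \<open>Every generator is homogeneous in length, so the projection keeps it or sends it to
  0.\<close>

lemma restr_length_ideal:
  assumes "f \<in> OS_ideal dep B"
  shows "restr (\<lambda>w. length w = n) f \<in> OS_ideal dep B"
proof (rule linear_ideal_into[OF linear_restr subspace_OS_ideal _ assms])
  fix u v and r :: "'a list \<Rightarrow> 'b" assume *: "u \<in> lists B" "v \<in> lists B" "r \<in> OS_relations dep B"
  obtain m where "lmul u (rmul r v) \<in> wspan {w. length w = m}" using gen_homogeneous[OF *(3)] .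
  then show "restr (\<lambda>w. length w = n) (lmul u (rmul r v)) \<in> OS_ideal dep B"
    using gen_in_ideal[OF *(3,1,2)] by (auto simp: restr_wspan_cases fs.subspace_0)
qed

lemma sgn_twist_homogeneous:
  assumes "f \<in> wspan {w. length w = n}"
  shows "sgn_twist f = fscale ((-1) ^ n) f"
  by (rule linear_eq_on_wspan[OF linear_sgn_twist _ _ assms])
     (auto simp: sgn_twist_word intro!: flinearI simp: pointwise algebra_simps)

lemma sgn_twist_ideal:
  assumes "f \<in> OS_ideal dep B"
  shows "sgn_twist f \<in> OS_ideal dep B"
proof (rule linear_ideal_into[OF linear_sgn_twist subspace_OS_ideal _ assms])
  fix u v and r :: "'a list \<Rightarrow> 'b" assume *: "u \<in> lists B" "v \<in> lists B" "r \<in> OS_relations dep B"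
  obtain m where "lmul u (rmul r v) \<in> wspan {w. length w = m}" using gen_homogeneous[OF *(3)] .
  then show "sgn_twist (lmul u (rmul r v)) \<in> OS_ideal dep B"
    using gen_in_ideal[OF *(3,1,2)] by (simp add: sgn_twist_homogeneous fs.subspace_scale)
qed

lemma gen_wspan_UNIV: "r \<in> OS_relations dep B \<Longrightarrow> lmul u (rmul r v) \<in> wspan UNIV"
  using lmul_wspan[of u UNIV "rmul r v"] rmul_wspan[of v UNIV r] wspan_mono[of "lists B" UNIV]
    relation_wspan[of r dep B] by auto

text \<open>Peeling letters off \<open>u\<close> from the left and off \<open>v\<close> from the right in \<open>u r v\<close> avoids products of two
  general elements.\<close>

lemma der_ideal:
  assumes "f \<in> OS_ideal dep B"
  shows "der f \<in> OS_ideal dep B"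
proof (rule linear_ideal_into[OF linear_der subspace_OS_ideal _ assms])
  fix u v and r :: "'a list \<Rightarrow> 'b" assume *: "u \<in> lists B" "v \<in> lists B" "r \<in> OS_relations dep B"
  have right: "der (rmul r v) \<in> OS_ideal dep B" if "v \<in> lists B" for v
    using that
  proof (induction v rule: rev_induct)
    case Nil
    show ?case using der_relation[OF *(3)] by (simp add: fs.subspace_0)
  next
    case (snoc h v)
    have r: "rmul r v \<in> OS_ideal dep B" using gen_in_ideal[OF *(3), of "[]" v] snoc by auto
    have "der (rmul r (v @ [h])) = rmul (der (rmul r v)) [h] + sgn_twist (rmul r v)"
      using gen_wspan_UNIV[OF *(3), of "[]" v] by (simp add: der_rmul rmul_rmul[symmetric])
    then show ?case using snoc r by (auto intro!: fs.subspace_add rmul_ideal sgn_twist_ideal)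
  qed
  show "der (lmul u (rmul r v)) \<in> OS_ideal dep B"
    using *(1)
  proof (induction u)
    case (Cons h u)
    have "der (lmul (h # u) (rmul r v)) = lmul u (rmul r v) - lmul [h] (der (lmul u (rmul r v)))"
      using gen_wspan_UNIV[OF *(3), of u v] der_lmul[of "lmul u (rmul r v)" h] by (simp add: lmul_lmul)
    moreover have "lmul u (rmul r v) \<in> OS_ideal dep B" using Cons * by (intro gen_in_ideal) auto
    ultimately show ?case using Cons * by (auto intro!: fs.subspace_diff lmul_ideal)
  qed (use right * in simp)
qed

lemma square_in_ideal: "H \<in> B \<Longrightarrow> v \<in> lists B \<Longrightarrow> word (H # H # v) \<in> OS_ideal dep B"
  using gen_in_ideal[OF square_relation, of H B "[]" v dep] by simp

lemma anti_in_ideal: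
  "H \<in> B \<Longrightarrow> K \<in> B \<Longrightarrow> v \<in> lists B \<Longrightarrow> word (H # K # v) + word (K # H # v) \<in> OS_ideal dep B"
  using gen_in_ideal[OF anti_relation, of H B K "[]" v dep] by (simp add: rmul_add)

lemma square_lmul_in_ideal:
  "H \<in> B \<Longrightarrow> f \<in> wspan (lists B) \<Longrightarrow> lmul [H, H] f \<in> OS_ideal dep B"
  by (rule linear_wspan_into[OF linear_lmul subspace_OS_ideal, of "lists B"])
     (auto intro: square_in_ideal)

lemma anti_lmul_in_ideal:
  "H \<in> B \<Longrightarrow> K \<in> B \<Longrightarrow> f \<in> wspan (lists B) \<Longrightarrow> lmul [H, K] f + lmul [K, H] f \<in> OS_ideal dep B"
  by (rule linear_wspan_into[OF linear_plus[OF linear_lmul linear_lmul] subspace_OS_ideal, of "lists B"])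
     (auto intro: anti_in_ideal)

text \<open>Multiplying the relation \<open>bdry w\<close> by the first letter of \<open>w\<close>
  gives back \<open>word w\<close> up to a term that begins with a square.\<close>

lemma dependent_word_in_ideal:
  assumes "w \<in> lists B" "dep w" "w \<noteq> []"
  shows "word w \<in> OS_ideal dep B"
proof -
  obtain h t where w: "w = h # t" using assms(3) by (cases w) auto
  have "word w = lmul [h] (bdry w) + lmul [h, h] (bdry t)"
    by (simp add: w bdry_Cons lmul_diff lmul_lmul)
  moreover have "lmul [h] (bdry w) \<in> OS_ideal dep B"
    using assms w by (intro lmul_ideal relation_in_ideal bdry_relation) auto
  moreover have "lmul [h, h] (bdry t) \<in> OS_ideal dep B"
    using assms w by (auto intro!: square_lmul_in_ideal bdry_wspan)
  ultimately show ?thesis by (metis fs.subspace_add subspace_OS_ideal)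
qed

text \<open>A constant term could come only from the boundary of a one-letter tuple, and those
  tuples are independent.\<close>

lemma ideal_no_constants:
  assumes "\<And>H. H \<in> B \<Longrightarrow> \<not> dep [H]" "f \<in> OS_ideal dep B"
  shows "f [] = 0"
proof -
  have sub: "fs.subspace {f :: 'a list \<Rightarrow> 'b. f [] = 0}"
    by (auto simp: fs.subspace_def pointwise)
  have "f \<in> {f. f [] = 0}"
  proof (rule linear_ideal_into[OF linear_id sub _ assms(2)])
    fix u v and r :: "'a list \<Rightarrow> 'b" assume *: "u \<in> lists B" "v \<in> lists B" "r \<in> OS_relations dep B"
    have "r [] = 0"
      using *(3)
    proof (cases rule: OS_relationsE)
      case (bdry hs)
      then have "length hs \<noteq> 1" using assms(1) by (auto simp: length_Suc_conv)
      then have "[] \<notin> {v. set v \<subseteq> set hs \<and> Suc (length v) = length hs}" by auto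
      then show ?thesis using bdry bdry_in_wspan[of hs, where 'b = 'b] by (auto simp: wspan_iff)
    qed (auto simp: word_apply pointwise)
    then show "lmul u (rmul r v) \<in> {f. f [] = 0}"
      by (auto simp: lmul_def rmul_def)
  qed
  then show ?thesis by simp
qed

section \<open>Gradings and a criterion for membership in the ideal\<close>

lemma restr_decomposition:
  assumes "finite {w. q w \<noteq> 0}"
  shows "q = (\<Sum>x\<in>key ` {w. q w \<noteq> 0}. restr (\<lambda>w. key w = x) q)"
proof
  fix w
  have "(\<Sum>x\<in>key ` {w. q w \<noteq> 0}. restr (\<lambda>w. key w = x) q w)
      = (\<Sum>x\<in>key ` {w. q w \<noteq> 0}. if x = key w then q w else 0)"
    by (intro sum.cong) (auto simp: restr_def)
  also have "\<dots> = q w" using assms by (auto simp: sum.delta)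
  finally show "q w = (\<Sum>x\<in>key ` {w. q w \<noteq> 0}. restr (\<lambda>w. key w = x) q) w"
    by (simp add: sum_fun_apply)
qed

text \<open>Let \<open>p\<close> be a component of fixed length and flat, and \<open>h\<close> a
  letter in it. By \<open>dep\<close>, all words of e_h p are dependent, and p = der (e_h p) + e_h
  (der p) with \<open>der p\<close> shorter. The flat and the dependence stay abstract because the
  criterion is used both in \<open>V\<close> and inside \<open>H0\<close>.\<close>

lemma graded_subspace_subset_ideal:
  fixes Q :: "('h list \<Rightarrow> 'k::field) set" and fl :: "'h list \<Rightarrow> 'f"
  assumes sub: "fs.subspace Q" and Q: "Q \<subseteq> wspan (lists B)"
    and der: "\<And>q. q \<in> Q \<Longrightarrow> der q \<in> Q"
    and len: "\<And>q n. q \<in> Q \<Longrightarrow> restr (\<lambda>w. length w = n) q \<in> Q"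
    and flat: "\<And>q X. q \<in> Q \<Longrightarrow> restr (\<lambda>w. fl w = X) q \<in> Q"
    and const: "\<And>q. q \<in> Q \<Longrightarrow> q [] = 0"
    and dep: "\<And>h w w'. \<lbrakk>w \<in> lists B; w' \<in> lists B; h \<in> set w; fl w = fl w'; length w = length w'\<rbrakk>
      \<Longrightarrow> dep (h # w')"
  shows "Q \<subseteq> OS_ideal dep B"
proof -
  have homogeneous: "q \<in> Q \<Longrightarrow> q \<in> wspan {w \<in> lists B. length w = n} \<Longrightarrow> q \<in> OS_ideal dep B" for q n
  proof (induction n arbitrary: q)
    case 0
    have "q = 0"
    proof
      fix w
      show "q w = 0 w" using 0 const[OF 0(1)] by (cases w) (auto simp: wspan_iff pointwise)
    qed
    then show ?case by (simp add: fs.subspace_0)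
  next
    case (Suc n)
    have fin: "finite {w. q w \<noteq> 0}" using Suc.prems by (simp add: wspan_iff)
    have "restr (\<lambda>w. fl w = X) q \<in> OS_ideal dep B" for X
    proof (cases "restr (\<lambda>w. fl w = X) q = 0")
      case False
      define p where "p = restr (\<lambda>w. fl w = X) q"
      have "p \<in> Q" using Suc.prems flat by (simp add: p_def)
      have p: "p \<in> wspan {w \<in> lists B. length w = Suc n \<and> fl w = X}" (is "_ \<in> wspan ?L")
        using Suc.prems by (auto simp: p_def wspan_iff restr_def elim: finite_subset[rotated])
      \<comment> \<open>Any word of \<open>p\<close> will do: its head can be prefixed to every
        other word of \<open>p\<close>, since all have the same flat and length.\<close>
      obtain w0 where w0: "p w0 \<noteq> 0" using False by (auto simp: p_def pointwise)
      then have w0L: "w0 \<in> ?L" using p by (auto simp: wspan_iff)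
      then obtain h t where ht: "w0 = h # t" by (cases w0) auto
      have hB: "[h] \<in> lists B" using w0L ht by auto
      have "lmul [h] p \<in> OS_ideal dep B"
      proof (rule linear_wspan_into[OF linear_lmul subspace_OS_ideal _ p])
        fix w assume "w \<in> ?L"
        then have "dep (h # w)" using w0L ht by (intro dep[of w0]) auto
        then show "lmul [h] (word w) \<in> OS_ideal dep B"
          using \<open>w \<in> ?L\<close> hB by (auto intro!: dependent_word_in_ideal)
      qed
      \<comment> \<open>\<open>der p\<close> may involve several flats, which is why the induction
        statement fixes the length alone.\<close>
      moreover have "der p \<in> OS_ideal dep B"
      proof (rule Suc.IH)
        show "der p \<in> Q" using \<open>p \<in> Q\<close> by (rule der)
        show "der p \<in> wspan {w \<in> lists B. length w = n}"
        proof (rule linear_wspan_into[OF linear_der subspace_wspan _ p])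
          fix w assume "w \<in> ?L"
          then show "der (word w) \<in> wspan {w \<in> lists B. length w = n}"
            using subsetD[OF wspan_mono bdry_in_wspan[of w], of "{w \<in> lists B. length w = n}"]
            by auto
        qed
      qed
      moreover have "p = der (lmul [h] p) + lmul [h] (der p)"
        using der_lmul[of p h] subsetD[OF wspan_mono p, of UNIV] by simp
      ultimately show ?thesis
        unfolding p_def[symmetric] using hB
        by (metis der_ideal lmul_ideal fs.subspace_add subspace_OS_ideal)
    qed (simp add: fs.subspace_0)
    then show ?case
      using restr_decomposition[OF fin, of fl] by (metis fs.subspace_sum subspace_OS_ideal)
  qed
  show ?thesis
  proof
    fix q assume "q \<in> Q"
    then have q: "finite {w. q w \<noteq> 0}" "{w. q w \<noteq> 0} \<subseteq> lists B" using Q wspan_iff[of q "lists B"] by auto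
    have "restr (\<lambda>w. length w = n) q \<in> OS_ideal dep B" for n
    proof (rule homogeneous[of _ n])
      show "restr (\<lambda>w. length w = n) q \<in> Q" using \<open>q \<in> Q\<close> by (rule len)
      show "restr (\<lambda>w. length w = n) q \<in> wspan {w \<in> lists B. length w = n}"
        using q by (auto simp: wspan_iff restr_def elim: finite_subset[rotated])
    qed
    then show "q \<in> OS_ideal dep B"
      using restr_decomposition[OF q(1), of length] by (metis fs.subspace_sum subspace_OS_ideal)
  qed
qed

text \<open>A term of \<open>\<partial>(hs)\<close> whose flat differs from that of \<open>hs\<close> omits a coloop of \<open>hs\<close>, so it is still
  dependent and already lies in the ideal.\<close>

lemma restr_flat_ideal:
  assumes set: "\<And>w w'. set w = set w' \<Longrightarrow> fl w = fl w'"
    and coloop: "\<And>u hs v k. \<lbrakk>hs \<in> lists B; dep hs; k < length hs;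
        fl (u @ take k hs @ drop (Suc k) hs @ v) \<noteq> fl (u @ hs @ v)\<rbrakk>
      \<Longrightarrow> dep (take k hs @ drop (Suc k) hs) \<and> take k hs @ drop (Suc k) hs \<noteq> []"
    and f: "f \<in> OS_ideal dep B"
  shows "restr (\<lambda>w. fl w = X) f \<in> OS_ideal dep B"
proof (rule linear_ideal_into[OF linear_restr subspace_OS_ideal _ f])
  fix u v and r :: "'a list \<Rightarrow> 'c" assume *: "u \<in> lists B" "v \<in> lists B" "r \<in> OS_relations dep B"
  note gen = gen_in_ideal[OF *(3,1,2)]
  show "restr (\<lambda>w. fl w = X) (lmul u (rmul r v)) \<in> OS_ideal dep B"
    using *(3)
  proof (cases rule: OS_relationsE)
    case (square H)
    then show ?thesis using gen by (auto simp: fs.subspace_0)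
  next
    case (anti H K)
    have "fl (u @ H # K # v) = fl (u @ K # H # v)" by (rule set) auto
    then show ?thesis
      using gen anti by (auto simp: fs.subspace_0 rmul_add lmul_add fsp.linear_add[OF linear_restr])
  next
    case (bdry hs)
    define t where "t k = fscale ((-1) ^ k) (word (u @ take k hs @ drop (Suc k) hs @ v) :: 'a list \<Rightarrow> 'c)" for k
    define g where "g k = fl (u @ take k hs @ drop (Suc k) hs @ v)" for k
    have sum: "lmul u (rmul r v) = (\<Sum>k<length hs. t k)"
      by (simp add: bdry bdry_alt t_def fsp.linear_sum[OF linear_lmul] fsp.linear_sum[OF linear_rmul]
          lmul_scale rmul_scale)
    have t: "restr (\<lambda>w. fl w = X) (t k) = (if g k = X then t k else 0)" for k
      by (simp add: t_def g_def fsp.linear_scale[OF linear_restr])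
    have mem: "t k \<in> OS_ideal dep B" if k: "k < length hs" "g k \<noteq> fl (u @ hs @ v)" for k
    proof -
      have "take k hs @ drop (Suc k) hs \<in> lists B" using bdry(1) by (auto dest: in_set_takeD in_set_dropD)
      then have "word (take k hs @ drop (Suc k) hs) \<in> OS_ideal dep B"
        using coloop[OF bdry(1,2) k(1) k(2)[unfolded g_def]] by (intro dependent_word_in_ideal) auto
      then have "lmul u (rmul (word (take k hs @ drop (Suc k) hs)) v) \<in> OS_ideal dep B"
        using * by (intro lmul_ideal rmul_ideal)
      then show ?thesis by (auto simp: t_def intro!: fs.subspace_scale)
    qed
    have restr: "restr (\<lambda>w. fl w = X) (lmul u (rmul r v)) = (\<Sum>k<length hs. if g k = X then t k else 0)"
      by (simp add: sum fsp.linear_sum[OF linear_restr] t)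
    show ?thesis
    \<comment> \<open>For the flat of the whole word the projection is the generator minus the terms
      of other flats; for any other \<open>X\<close> it consists of such terms only. These lie in
      the ideal by \<open>mem\<close>.\<close>
    proof (cases "X = fl (u @ hs @ v)")
      case True
      have eq: "(\<Sum>k<length hs. if g k = X then t k else 0)
          = lmul u (rmul r v) - (\<Sum>k<length hs. if g k = X then 0 else t k)"
        by (simp add: sum sum_subtractf[symmetric] if_distrib cong: if_cong)
      show ?thesis
        unfolding restr eq
        using gen mem True by (auto simp: fs.subspace_0 intro!: fs.subspace_diff fs.subspace_sum)
    next
      case False
      then show ?thesis
        using mem by (auto simp: restr fs.subspace_0 intro!: fs.subspace_sum)
    qed
  qed
qed

section \<open>Substitution of letters\<close>

text \<open>The homomorphism of free algebras given by a map of letters. It is applied to the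
  restriction \<open>R\<close> and to a section of it.\<close>

definition lmap :: "('a \<Rightarrow> 'b) \<Rightarrow> ('a list \<Rightarrow> 'k::field) \<Rightarrow> 'b list \<Rightarrow> 'k" where
  "lmap f = lin_ext (\<lambda>w. word (map f w))"

lemma linear_lmap [intro, simp]: "flinear (lmap f)"
  by (simp add: lmap_def)

lemma lmap_word [simp]: "lmap f (word w) = word (map f w)"
  by (simp add: lmap_def)

lemmas lmap_add = fsp.linear_add[OF linear_lmap]
lemmas lmap_diff = fsp.linear_diff[OF linear_lmap]

lemma lmap_wspan: "q \<in> wspan L \<Longrightarrow> lmap f q \<in> wspan (map f ` L)"
  by (rule linear_wspan_into[OF linear_lmap]) auto

lemma lmap_lmul:
  assumes "q \<in> wspan UNIV"
  shows "lmap f (lmul u q) = lmul (map f u) (lmap f q)"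
  by (rule linear_eq_on_wspan[OF linear_compose[OF linear_lmap linear_lmul]
        linear_compose[OF linear_lmul linear_lmap] _ assms]) simp

lemma lmap_rmul:
  assumes "q \<in> wspan UNIV"
  shows "lmap f (rmul q v) = rmul (lmap f q) (map f v)"
  by (rule linear_eq_on_wspan[OF linear_compose[OF linear_lmap linear_rmul]
        linear_compose[OF linear_rmul linear_lmap] _ assms]) simp

lemma lmap_bdry: "lmap f (bdry w) = bdry (map f w)"
  by (simp add: bdry_alt fsp.linear_sum[OF linear_lmap] fsp.linear_scale[OF linear_lmap]
      take_map drop_map)

lemma lmap_der:
  assumes "q \<in> wspan UNIV"
  shows "lmap f (der q) = der (lmap f q)"
  by (rule linear_eq_on_wspan[OF linear_compose[OF linear_lmap linear_der]
        linear_compose[OF linear_der linear_lmap] _ assms]) (simp add: lmap_bdry)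

lemma restr_lmap:
  assumes "q \<in> wspan UNIV"
  shows "restr P (lmap f q) = lmap f (restr (\<lambda>w. P (map f w)) q)"
  by (rule linear_eq_on_wspan[OF linear_compose[OF linear_restr linear_lmap]
        linear_compose[OF linear_lmap linear_restr] _ assms])
     (simp add: fsp.linear_0[OF linear_lmap])

lemma restr_lmul:
  assumes "q \<in> wspan UNIV"
  shows "restr P (lmul u q) = lmul u (restr (\<lambda>w. P (u @ w)) q)"
  by (rule linear_eq_on_wspan[OF linear_compose[OF linear_restr linear_lmul]
        linear_compose[OF linear_lmul linear_restr] _ assms]) simp

lemma restr_wspan: "q \<in> wspan L \<Longrightarrow> restr P q \<in> wspan L"
  by (auto simp: wspan_iff restr_def elim: finite_subset[rotated])

section \<open>Ranks of intersections of hyperplanes\<close>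

lemma subspace_lin_hyperplane: "lin_hyperplane H \<Longrightarrow> vec.subspace H"
  unfolding lin_hyperplane_def vec.subspace_def
  by (auto simp: algebra_simps sum.distrib sum_distrib_left[symmetric])

lemma lin_hyperplane_not_UNIV:
  assumes "lin_hyperplane (H :: ('k::field ^ 'n) set)"
  shows "H \<noteq> UNIV"
proof
  assume "H = UNIV"
  obtain a where a: "a \<noteq> 0" "H = {x. (\<Sum>i\<in>UNIV. a $ i * x $ i) = 0}"
    using assms by (auto simp: lin_hyperplane_def)
  obtain i where "a $ i \<noteq> 0" using a(1) by (auto simp: vec_eq_iff)
  moreover have "(\<Sum>j\<in>UNIV. a $ j * axis i 1 $ j) = a $ i"
    by (simp add: axis_def if_distrib cong: if_cong)
  ultimately have "axis i 1 \<notin> H" using a(2) by simp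
  then show False using \<open>H = UNIV\<close> by simp
qed

text \<open>If \<open>S\<close> is not inside \<open>H\<close>, one vector \<open>y\<close> of
  \<open>S\<close> outside \<open>H\<close> spans \<open>S\<close> together with
  \<open>S \<inter> H\<close>: subtracting a multiple of \<open>y\<close> makes the defining form
  vanish.\<close>

lemma dim_inter_lin_hyperplane:
  fixes S :: "('k::field ^ 'n) set"
  assumes "lin_hyperplane H" "vec.subspace S"
  shows "vec.dim S \<le> Suc (vec.dim (S \<inter> H))"
proof (cases "S \<subseteq> H")
  case True
  then show ?thesis by (simp add: Int_absorb2)
next
  case False
  obtain a where H: "H = {x. (\<Sum>i\<in>UNIV. a $ i * x $ i) = 0}"
    using assms by (auto simp: lin_hyperplane_def)
  define \<phi> where "\<phi> x = (\<Sum>i\<in>UNIV. a $ i * x $ i)" for x :: "'k ^ 'n"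
  obtain y where y: "y \<in> S" "\<phi> y \<noteq> 0" using False by (auto simp: H \<phi>_def)
  have "S \<subseteq> vec.span (insert y (S \<inter> H))"
  proof
    fix x assume x: "x \<in> S"
    define c where "c = \<phi> x / \<phi> y"
    have "\<phi> (x - c *s y) = \<phi> x - c * \<phi> y"
      by (simp add: \<phi>_def algebra_simps sum_subtractf sum_distrib_left)
    then have "x - c *s y \<in> S \<inter> H"
      using x y assms(2) by (auto simp: c_def H \<phi>_def[symmetric] intro!: vec.subspace_diff vec.subspace_scale)
    then show "x \<in> vec.span (insert y (S \<inter> H))"
      unfolding vec.span_insert by (auto intro: vec.span_base)
  qed
  then have "vec.dim S \<le> vec.dim (insert y (S \<inter> H))"
    by (metis vec.dim_span vec.dim_subset)
  also have "\<dots> \<le> Suc (vec.dim (S \<inter> H))"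
    by (simp add: vec.dim_insert)
  finally show ?thesis .
qed

text \<open>Members of \<open>A''\<close> are hyperplanes of \<open>H0\<close>, not of
  \<open>V\<close>. This notion covers \<open>W = UNIV\<close> and \<open>W = H0\<close> at once;
  the trace may be all of \<open>W\<close>, since only codimension at most one matters.\<close>

definition cut_by_hyperplane :: "('k::field ^ 'n) set \<Rightarrow> ('k ^ 'n) set \<Rightarrow> bool" where
  "cut_by_hyperplane W X \<longleftrightarrow> (\<exists>H. lin_hyperplane H \<and> W \<inter> X = W \<inter> H)"

lemma subspace_cut:
  assumes "vec.subspace W" "\<forall>X\<in>set hs. cut_by_hyperplane W X"
  shows "vec.subspace (W \<inter> \<Inter>(set hs))"
  using assms(2)
proof (induction hs)
  case (Cons X hs)
  obtain H where H: "lin_hyperplane H" "W \<inter> X = W \<inter> H"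
    using Cons.prems by (auto simp: cut_by_hyperplane_def)
  have "W \<inter> \<Inter>(set (X # hs)) = (W \<inter> \<Inter>(set hs)) \<inter> H" using H(2) by auto
  then show ?case
    using vec.subspace_inter[OF Cons.IH subspace_lin_hyperplane[OF H(1)]] Cons.prems by simp
qed (use assms in simp)

lemma rank_le_length:
  assumes "vec.subspace W" "\<forall>X\<in>set hs. cut_by_hyperplane W X"
  shows "vec.dim W \<le> length hs + vec.dim (W \<inter> \<Inter>(set hs))"
  using assms(2)
proof (induction hs)
  case (Cons X hs)
  obtain H where H: "lin_hyperplane H" "W \<inter> X = W \<inter> H"
    using Cons.prems by (auto simp: cut_by_hyperplane_def)
  have "W \<inter> \<Inter>(set (X # hs)) = (W \<inter> \<Inter>(set hs)) \<inter> H" using H(2) by auto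
  moreover have "vec.dim (W \<inter> \<Inter>(set hs)) \<le> Suc (vec.dim ((W \<inter> \<Inter>(set hs)) \<inter> H))"
    using Cons.prems H(1) assms(1) by (intro dim_inter_lin_hyperplane subspace_cut) auto
  ultimately show ?case using Cons by auto
qed simp

definition flat :: "'a set \<Rightarrow> 'a set list \<Rightarrow> 'a set" where
  "flat W w = W \<inter> \<Inter>(set w)"

text \<open>The letter \<open>h\<close> contains the flat of \<open>w\<close>, hence that of
  \<open>w'\<close>. Prefixing it leaves the intersection unchanged, and its codimension is at most
  \<open>length w'\<close>. This supplies the hypothesis \<open>dep\<close> of the
  criterion.\<close>

lemma lin_dependent_overfull:
  assumes "vec.subspace W" "\<forall>X\<in>set w'. cut_by_hyperplane W X"
    "h \<in> set w" "flat W w = flat W w'"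
  shows "lin_dependent W (h # w')"
proof -
  have "W \<inter> \<Inter>(set (h # w')) = W \<inter> \<Inter>(set w')"
    using assms(3,4) by (auto simp: flat_def)
  then show ?thesis using rank_le_length[OF assms(1,2)] by (simp add: lin_dependent_def)
qed

lemma cut_UNIV: "lin_hyperplane H \<Longrightarrow> cut_by_hyperplane UNIV H"
  by (auto simp: cut_by_hyperplane_def)

lemma dim_strict_mono:
  assumes "vec.subspace S" "vec.subspace T" "S \<subset> T"
  shows "vec.dim S < vec.dim T"
  using vec.subspace_dim_equal[OF assms(1,2)] assms(3)
  by (cases "vec.dim T \<le> vec.dim S") auto

text \<open>Omitting a letter whose loss changes the flat lowers the codimension by at least one and
  the length by exactly one, so dependence survives.\<close>

lemma lin_dependent_coloop:
  fixes hs :: "('k::field ^ 'n) set list"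
  assumes hyp: "\<forall>H\<in>set hs. lin_hyperplane H" and dep: "lin_dependent UNIV hs" and k: "k < length hs"
    and flat: "flat UNIV (u @ take k hs @ drop (Suc k) hs @ v) \<noteq> flat UNIV (u @ hs @ v)"
  shows "lin_dependent UNIV (take k hs @ drop (Suc k) hs)"
proof -
  define g where "g = take k hs @ drop (Suc k) hs"
  have hs: "hs = take k hs @ hs ! k # drop (Suc k) hs" using k by (rule id_take_nth_drop)
  have set: "set hs = insert (hs ! k) (set g)" unfolding g_def by (subst hs) auto
  \<comment> \<open>If the intersection of \<open>hs\<close> itself were unchanged, that of the word
    around it would be too.\<close>
  then have ne: "\<Inter>(set hs) \<noteq> \<Inter>(set g)" using flat by (auto simp: flat_def g_def)
  have cut: "\<forall>X\<in>set hs. cut_by_hyperplane UNIV X" using hyp cut_UNIV by auto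
  have "vec.subspace (\<Inter>(set hs))" "vec.subspace (\<Inter>(set g))"
    using subspace_cut[of UNIV hs] subspace_cut[of UNIV g] cut set by auto
  then have "vec.dim (\<Inter>(set hs)) < vec.dim (\<Inter>(set g))"
    using set ne by (intro dim_strict_mono) auto
  moreover have "vec.dim (\<Inter>(set g)) \<le> vec.dim (UNIV :: ('k ^ 'n) set)"
    by (intro vec.dim_subset) auto
  moreover have "length hs = Suc (length g)" using k by (auto simp: g_def)
  ultimately have "lin_dependent UNIV g" using dep unfolding lin_dependent_def Int_UNIV_left by linarith
  then show ?thesis by (simp add: g_def)
qed

lemma dim_lin_hyperplane_less:
  assumes "lin_hyperplane (H :: ('k::field ^ 'n) set)"
  shows "vec.dim H < vec.dim (UNIV :: ('k ^ 'n) set)"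
  using lin_hyperplane_not_UNIV[OF assms]
  by (intro dim_strict_mono subspace_lin_hyperplane assms vec.subspace_UNIV) auto

lemma not_lin_dependent_single:
  assumes "lin_hyperplane H"
  shows "\<not> lin_dependent UNIV [H]"
  using dim_lin_hyperplane_less[OF assms] by (simp add: lin_dependent_def)

lemma dim_lin_hyperplane:
  assumes "lin_hyperplane (H :: ('k::field ^ 'n) set)"
  shows "vec.dim (UNIV :: ('k ^ 'n) set) = Suc (vec.dim H)"
  using dim_lin_hyperplane_less[OF assms] dim_inter_lin_hyperplane[OF assms vec.subspace_UNIV]
  by (simp add: Int_UNIV_left)

section \<open>Deletion and restriction\<close>

locale arrangement_triple =
  fixes A :: "('k::field ^ 'n) set set" and H0 :: "('k ^ 'n) set"
  assumes arr: "central_arrangement A" and H0: "H0 \<in> A"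
begin

abbreviation A' where "A' \<equiv> A - {H0}"
abbreviation A'' where "A'' \<equiv> restr_arr A H0"
abbreviation T where "T \<equiv> (wspan (lists A) :: (('k ^ 'n) set list \<Rightarrow> 'k) set)"
abbreviation T' where "T' \<equiv> (wspan (lists A') :: (('k ^ 'n) set list \<Rightarrow> 'k) set)"
abbreviation T'' where "T'' \<equiv> (wspan (lists A'') :: (('k ^ 'n) set list \<Rightarrow> 'k) set)"
abbreviation I where "I \<equiv> (OS_ideal (lin_dependent UNIV) A :: (('k ^ 'n) set list \<Rightarrow> 'k) set)"
abbreviation I' where "I' \<equiv> (OS_ideal (lin_dependent UNIV) A' :: (('k ^ 'n) set list \<Rightarrow> 'k) set)"
abbreviation I'' where "I'' \<equiv> (OS_ideal (lin_dependent H0) A'' :: (('k ^ 'n) set list \<Rightarrow> 'k) set)"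
abbreviation R where "R H \<equiv> H \<inter> H0"

lemma hyperplane: "H \<in> A \<Longrightarrow> lin_hyperplane H"
  using arr by (simp add: central_arrangement_def)

lemma T_UNIV: "f \<in> wspan L \<Longrightarrow> f \<in> wspan UNIV"
  using wspan_mono[of L UNIV] by auto

lemma A''_eq: "A'' = R ` A'"
  by (auto simp: restr_arr_def)

lemma cut_A'': "X \<in> A'' \<Longrightarrow> cut_by_hyperplane H0 X"
  using hyperplane by (auto simp: A''_eq cut_by_hyperplane_def)

text \<open>Both tuples have the same intersection, while codimension and length are each one
  smaller inside \<open>H0\<close>.\<close>

lemma lin_dependent_restriction:
  "lin_dependent H0 (map R hs) \<longleftrightarrow> lin_dependent UNIV (H0 # hs)"
proof -
  have eq: "H0 \<inter> \<Inter>(set (map R hs)) = \<Inter>(set (H0 # hs))" by auto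
  have "vec.dim (\<Inter>(set (H0 # hs))) \<le> vec.dim H0"
    by (intro vec.dim_subset) auto
  then show ?thesis
    using dim_lin_hyperplane[OF hyperplane[OF H0]]
    unfolding lin_dependent_def Int_UNIV_left length_map length_Cons eq
    by (intro iffI) linarith+
qed

lemma restr_flat_I: "f \<in> I \<Longrightarrow> restr (\<lambda>w. flat UNIV w = X) f \<in> I"
proof (rule restr_flat_ideal)
  fix u hs v :: "('k ^ 'n) set list" and k
  assume "hs \<in> lists A" "lin_dependent UNIV hs" "k < length hs"
    "flat UNIV (u @ take k hs @ drop (Suc k) hs @ v) \<noteq> flat UNIV (u @ hs @ v)"
  then have "lin_dependent UNIV (take k hs @ drop (Suc k) hs)"
    using hyperplane by (intro lin_dependent_coloop) auto
  then show "lin_dependent UNIV (take k hs @ drop (Suc k) hs) \<and> take k hs @ drop (Suc k) hs \<noteq> []"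
    by (metis lin_dependent_def list.size(3) not_less_zero)
qed (simp_all add: flat_def)

lemma I_no_constants: "f \<in> I \<Longrightarrow> f [] = 0"
  by (rule ideal_no_constants[of A]) (auto simp: not_lin_dependent_single hyperplane)

text \<open>This is injectivity of A(A') -> A(A). The intersection inherits from \<open>I\<close>
  stability under \<open>der\<close>, both gradings and the absence of constants, so the criterion
  applies to it.\<close>

lemma I_Int_T': "I \<inter> T' = I'"
proof
  show "I \<inter> T' \<subseteq> I'"
  proof (rule graded_subspace_subset_ideal[where fl = "flat UNIV"])
    fix h w w' assume "w \<in> lists A'" "w' \<in> lists A'" "h \<in> set w" "flat UNIV w = flat UNIV w'"
    then show "lin_dependent UNIV (h # w')"
      using hyperplane by (intro lin_dependent_overfull[of UNIV w' h w]) (auto intro: cut_UNIV)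
  qed (auto intro: der_ideal der_wspan restr_length_ideal restr_wspan restr_flat_I
        I_no_constants fs.subspace_inter)
  show "I' \<subseteq> I \<inter> T'"
    using ideal_mono[of A' A] ideal_subset_wspan[of _ A'] by auto
qed

text \<open>A(A) is A(A') + e_H0 A(A'): occurrences of \<open>H0\<close> move to the front by
  anticommutation, and repeated ones vanish.\<close>

lemma T_decomposition:
  assumes "x \<in> T"
  obtains p q where "p \<in> T'" "q \<in> T'" "x - p - lmul [H0] q \<in> I"
proof -
  define S where "S = {x. \<exists>p\<in>T'. \<exists>q\<in>T'. x - p - lmul [H0] q \<in> I}"
  have SI: "x \<in> S" if "p \<in> T'" "q \<in> T'" "x - p - lmul [H0] q \<in> I" for x p q
    using that by (auto simp: S_def)
  have S: "fs.subspace S"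
    unfolding fs.subspace_def
  proof (intro conjI ballI allI)
    show "0 \<in> S" by (rule SI[of 0 0]) (auto simp: fs.subspace_0)
  next
    fix x y assume "x \<in> S" "y \<in> S"
    then obtain p q p1 q1 where *: "p \<in> T'" "q \<in> T'" "x - p - lmul [H0] q \<in> I"
      "p1 \<in> T'" "q1 \<in> T'" "y - p1 - lmul [H0] q1 \<in> I" by (auto simp: S_def)
    have "(x + y) - (p + p1) - lmul [H0] (q + q1)
        = (x - p - lmul [H0] q) + (y - p1 - lmul [H0] q1)" by (simp add: lmul_add)
    also have "\<dots> \<in> I" using * by (intro fs.subspace_add) auto
    finally show "x + y \<in> S"
      using * by (intro SI[of "p + p1" "q + q1"]) (auto intro: fs.subspace_add)
  next
    fix c x assume "x \<in> S"
    then obtain p q where *: "p \<in> T'" "q \<in> T'" "x - p - lmul [H0] q \<in> I" by (auto simp: S_def)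
    have "fscale c x - fscale c p - lmul [H0] (fscale c q) = fscale c (x - p - lmul [H0] q)"
      by (simp add: lmul_scale fs.scale_right_diff_distrib)
    also have "\<dots> \<in> I" using * by (intro fs.subspace_scale) auto
    finally show "fscale c x \<in> S"
      using * by (intro SI[of "fscale c p" "fscale c q"]) (auto intro: fs.subspace_scale)
  qed
  have "word w \<in> S" if "w \<in> lists A" for w
    using that
  proof (induction w)
    case Nil
    have "word [] \<in> T'" by auto
    then show ?case by (intro SI[of "word []" 0]) (auto simp: fs.subspace_0)
  next
    case (Cons h w)
    then obtain p q where *: "p \<in> T'" "q \<in> T'" "word w - p - lmul [H0] q \<in> I" by (auto simp: S_def)
    have pq: "p \<in> T" "q \<in> T" using * wspan_mono[of "lists A'" "lists A"] by auto
    have h: "lmul [h] (word w - p - lmul [H0] q) \<in> I"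
      using * Cons by (intro lmul_ideal) auto
    show ?case
    proof (cases "h = H0")
      case True
      have "word (h # w) - 0 - lmul [H0] p = lmul [h] (word w - p - lmul [H0] q) + lmul [H0, H0] q"
        by (simp add: True lmul_diff lmul_lmul)
      also have "\<dots> \<in> I" using h pq H0 by (intro fs.subspace_add square_lmul_in_ideal) auto
      finally show ?thesis
        using * by (intro SI[of 0 p]) (auto simp: fs.subspace_0)
    next
      case False
      \<comment> \<open>Moving \<open>h\<close> past \<open>H0\<close> costs the sign in front of
        the new second component.\<close>
      have "word (h # w) - lmul [h] p - lmul [H0] (- lmul [h] q)
        = lmul [h] (word w - p - lmul [H0] q) + (lmul [h, H0] q + lmul [H0, h] q)"
        by (simp add: lmul_diff lmul_lmul fsp.linear_neg[OF linear_lmul])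
      also have "\<dots> \<in> I" using h pq H0 Cons by (intro fs.subspace_add anti_lmul_in_ideal) auto
      finally show ?thesis
        using * False Cons
        by (intro SI[of "lmul [h] p" "- lmul [h] q"]) (auto intro!: fs.subspace_neg lmul_wspan)
    qed
  qed
  then have "x \<in> S"
    using linear_wspan_into[OF linear_id S _ assms] by blast
  then show ?thesis using that by (auto simp: S_def)
qed

text \<open>\<open>K\<close> is the preimage in \<open>T'\<close> of the annihilator of \<open>e\<^sub>H\<^sub>0\<close> in \<open>A(\<A>) / A(\<A>')\<close>.\<close>

definition K :: "(('k ^ 'n) set list \<Rightarrow> 'k) set" where
  "K = {q \<in> T'. \<exists>p\<in>T'. lmul [H0] q - p \<in> I}"

lemma KI: "q \<in> T' \<Longrightarrow> p \<in> T' \<Longrightarrow> lmul [H0] q - p \<in> I \<Longrightarrow> q \<in> K"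
  by (auto simp: K_def)

lemma KE:
  assumes "q \<in> K"
  obtains p where "q \<in> T'" "p \<in> T'" "lmul [H0] q - p \<in> I"
  using assms by (auto simp: K_def)

lemma subspace_K: "fs.subspace K"
  unfolding fs.subspace_def
proof (intro conjI ballI allI)
  show "0 \<in> K" by (rule KI[of _ 0]) (auto simp: fs.subspace_0)
next
  fix x y assume "x \<in> K" "y \<in> K"
  then obtain p p1 where *: "x \<in> T'" "p \<in> T'" "lmul [H0] x - p \<in> I"
    "y \<in> T'" "p1 \<in> T'" "lmul [H0] y - p1 \<in> I" by (auto simp: K_def)
  have "lmul [H0] (x + y) - (p + p1) = (lmul [H0] x - p) + (lmul [H0] y - p1)"
    by (simp add: lmul_add)
  also have "\<dots> \<in> I" using * by (intro fs.subspace_add) auto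
  finally show "x + y \<in> K"
    using * by (intro KI[of _ "p + p1"]) (auto intro: fs.subspace_add)
next
  fix c x assume "x \<in> K"
  then obtain p where *: "x \<in> T'" "p \<in> T'" "lmul [H0] x - p \<in> I" by (auto simp: K_def)
  have "lmul [H0] (fscale c x) - fscale c p = fscale c (lmul [H0] x - p)"
    by (simp add: lmul_scale fs.scale_right_diff_distrib)
  also have "\<dots> \<in> I" using * by (intro fs.subspace_scale) auto
  finally show "fscale c x \<in> K"
    using * by (intro KI[of _ "fscale c p"]) (auto intro: fs.subspace_scale)
qed

text \<open>As \<open>h\<close> anticommutes with \<open>H0\<close>, the witness for e_h q is -e_h
  p. Together with \<open>rmul_K\<close> this makes \<open>K\<close> a two-sided ideal of
  \<open>T'\<close>.\<close>

lemma lmul_single_K: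
  assumes "h \<in> A'" "q \<in> K"
  shows "lmul [h] q \<in> K"
proof -
  obtain p where *: "q \<in> T'" "p \<in> T'" "lmul [H0] q - p \<in> I" using assms(2) by (rule KE)
  have "q \<in> T" using *(1) wspan_mono[of "lists A'" "lists A"] by auto
  have "lmul [H0] (lmul [h] q) - (- lmul [h] p)
      = (lmul [H0, h] q + lmul [h, H0] q) - lmul [h] (lmul [H0] q - p)"
    by (simp add: lmul_diff lmul_lmul)
  also have "\<dots> \<in> I"
    using assms(1) \<open>q \<in> T\<close> H0
    by (intro fs.subspace_diff[OF subspace_OS_ideal anti_lmul_in_ideal lmul_ideal[OF _ *(3)]]) auto
  finally show ?thesis
    using assms * by (intro KI[of _ "- lmul [h] p"]) (auto intro!: fs.subspace_neg lmul_wspan)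
qed

lemma lmul_K: "u \<in> lists A' \<Longrightarrow> q \<in> K \<Longrightarrow> lmul u q \<in> K"
proof (induction u)
  case (Cons h u)
  then show ?case using lmul_single_K[of h "lmul u q"] by (simp add: lmul_lmul)
qed simp

lemma rmul_K:
  assumes "v \<in> lists A'" "q \<in> K"
  shows "rmul q v \<in> K"
proof -
  obtain p where *: "q \<in> T'" "p \<in> T'" "lmul [H0] q - p \<in> I" using assms(2) by (rule KE)
  have "rmul (lmul [H0] q - p) v \<in> I" using assms * by (intro rmul_ideal) auto
  then have "lmul [H0] (rmul q v) - rmul p v \<in> I" by (simp add: rmul_diff lmul_rmul)
  then show ?thesis using assms * by (intro KI[of _ "rmul p v"]) (auto intro: rmul_wspan)
qed

lemma I'_subset_K: "I' \<subseteq> K"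
proof
  fix q assume "q \<in> I'"
  then have "q \<in> I" "q \<in> T'" using I_Int_T' by auto
  then show "q \<in> K" using H0 by (intro KI[of _ 0]) (auto simp: fs.subspace_0 intro!: lmul_ideal)
qed

text \<open>Expanding the relation \<open>bdry (H0 # hs)\<close> at its head shows e_H0 (bdry hs) =
  word hs modulo \<open>I\<close>. These elements lift the boundary relations of
  \<open>A''\<close>.\<close>

lemma bdry_in_K:
  assumes "hs \<in> lists A'" "lin_dependent UNIV (H0 # hs)"
  shows "bdry hs \<in> K"
proof (rule KI[of _ "word hs"])
  have "bdry (H0 # hs) \<in> I"
    using assms H0 by (intro relation_in_ideal bdry_relation) auto
  then have "- bdry (H0 # hs) \<in> I" by (intro fs.subspace_neg) auto
  then show "lmul [H0] (bdry hs) - word hs \<in> I" by (simp add: bdry_Cons)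
qed (use assms in \<open>auto intro!: bdry_wspan\<close>)

text \<open>If \<open>h\<close> and \<open>h'\<close> have the same trace on \<open>H0\<close>, then
  \<open>H0\<close>, \<open>h'\<close>, \<open>h\<close> are dependent, and
  \<open>bdry [h', h]\<close> is the difference of the two letters. Longer words are exchanged
  letter by letter.\<close>

lemma word_diff_in_K:
  assumes "w \<in> lists A'" "w' \<in> lists A'" "map R w = map R w'"
  shows "word w - word w' \<in> K"
  using assms
proof (induction w arbitrary: w')
  case Nil
  then show ?case using subspace_K by (simp add: fs.subspace_0)
next
  case (Cons h w)
  then obtain h' v where w': "w' = h' # v" by (cases w') auto
  have h: "h \<in> A'" "h' \<in> A'" "v \<in> lists A'"
    using Cons.hyps Cons.prems(1) unfolding w' by (simp_all only: Cons_in_lists_iff)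
  have R: "R h = R h'" "map R w = map R v"
    using Cons.prems(2) unfolding w' by (simp_all only: list.map list.inject)
  have cut: "cut_by_hyperplane H0 h" using h(1) cut_UNIV hyperplane by (auto simp: cut_by_hyperplane_def)
  \<comment> \<open>The two traces coincide, so this two-letter tuple has codimension at most one in
    \<open>H0\<close>.\<close>
  have "H0 \<inter> (h' \<inter> H0 \<inter> (h \<inter> H0)) = H0 \<inter> h" using R(1) by blast
  then have "lin_dependent H0 (map R [h', h])"
    using rank_le_length[of H0 "[h]"] cut subspace_lin_hyperplane[OF hyperplane[OF H0]]
    by (simp add: lin_dependent_def)
  then have "lin_dependent UNIV (H0 # [h', h])"
    unfolding lin_dependent_restriction .
  moreover have "[h', h] \<in> lists A'" using h by simp
  ultimately have "bdry [h', h] \<in> K" by (rule bdry_in_K[rotated])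
  then have 1: "word [h] - word [h'] \<in> K" by (simp add: bdry_Cons)
  have "word (h # w) - word w' = lmul [h] (word w - word v) + rmul (word [h] - word [h']) v"
    by (simp add: w' lmul_diff rmul_diff)
  also have "\<dots> \<in> K"
    using h 1 R(2) by (intro fs.subspace_add subspace_K lmul_K rmul_K Cons.IH) auto
  finally show ?case .
qed

text \<open>The component of e_H0 q - p of length 1 and flat \<open>H0\<close> is the constant term
  of \<open>q\<close> times e_H0, because \<open>p\<close> avoids \<open>H0\<close>. Its derivative
  is a constant in \<open>I\<close>, hence 0.\<close>

lemma K_const:
  assumes "q \<in> K"
  shows "q [] = 0"
proof -
  obtain p where *: "q \<in> T'" "p \<in> T'" "lmul [H0] q - p \<in> I" using assms by (rule KE)
  define g where "g = restr (\<lambda>w. flat UNIV w = H0) (restr (\<lambda>w. length w = 1) (lmul [H0] q - p))"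
  have p: "p [H0] = 0" using *(2) by (auto simp: wspan_iff)
  have "g = fscale (q []) (word [H0])"
  proof
    fix w
    show "g w = fscale (q []) (word [H0]) w"
      using p by (auto simp: g_def restr_def lmul_def flat_def pointwise word_apply length_Suc_conv
          split: if_splits)
  qed
  moreover have "g \<in> I" using * by (simp add: g_def restr_flat_I restr_length_ideal)
  ultimately have "der (fscale (q []) (word [H0])) \<in> I" by (metis der_ideal)
  then have "fscale (q []) (word []) \<in> I" by (simp add: der_scale bdry_Cons)
  from I_no_constants[OF this] show ?thesis by (simp add: pointwise word_apply)
qed

text \<open>One half of exactness in the middle: each closure property required by the criterion is
  pulled back from \<open>I\<close> along q -> e_H0 q - p.\<close>

lemma lmap_K_subset: "lmap R ` K \<subseteq> I''"
proof (rule graded_subspace_subset_ideal[where fl = "flat H0"])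
  show "fs.subspace (lmap R ` K)"
    by (intro fsp.linear_subspace_image linear_lmap subspace_K)
  show "lmap R ` K \<subseteq> T''"
  proof
    fix x assume "x \<in> lmap R ` K"
    then obtain q where "q \<in> T'" "x = lmap R q" by (auto elim: KE)
    moreover have "map R ` lists A' \<subseteq> lists A''" by (auto simp: A''_eq)
    ultimately show "x \<in> T''" using lmap_wspan[of q "lists A'" R] wspan_mono by blast
  qed
next
  fix x assume "x \<in> lmap R ` K"
  then obtain q where "x = lmap R q" "q \<in> K" by auto
  moreover from this(2) obtain p where "q \<in> T'" "p \<in> T'" "lmul [H0] q - p \<in> I" by (rule KE)
  ultimately have *: "x = lmap R q" "q \<in> K" "q \<in> T'" "p \<in> T'" "lmul [H0] q - p \<in> I" by auto
  note q = T_UNIV[OF *(3)] and p = T_UNIV[OF *(4)]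
  \<comment> \<open>By the Leibniz rule the witness for \<open>der q\<close> is
    \<open>q - der p\<close>.\<close>
  show "der x \<in> lmap R ` K"
  proof -
    have "- der (lmul [H0] q - p) \<in> I" using * by (intro fs.subspace_neg der_ideal) auto
    also have "- der (lmul [H0] q - p) = lmul [H0] (der q) - (q - der p)"
      by (simp add: der_diff der_lmul[OF q])
    finally have "der q \<in> K"
      using * by (intro KI[of _ "q - der p"]) (auto intro!: der_wspan fs.subspace_diff)
    then show ?thesis using * lmap_der[OF q, of R, symmetric] by auto
  qed
  show "restr (\<lambda>w. length w = n) x \<in> lmap R ` K" for n
  proof -
    \<comment> \<open>Multiplication by e_H0 raises the length by one, hence
      \<open>Suc n\<close>.\<close>
    have "restr (\<lambda>w. length w = Suc n) (lmul [H0] q - p) \<in> I"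
      using * by (intro restr_length_ideal) auto
    then have "restr (\<lambda>w. length w = n) q \<in> K"
      using * by (intro KI[of _ "restr (\<lambda>w. length w = Suc n) p"])
        (auto intro: restr_wspan simp: fsp.linear_diff[OF linear_restr] restr_lmul[OF q])
    then show ?thesis using * restr_lmap[OF q, of "\<lambda>w. length w = n" R] by auto
  qed
  show "restr (\<lambda>w. flat H0 w = X) x \<in> lmap R ` K" for X
  proof -
    \<comment> \<open>The flat in \<open>V\<close> of a word headed by \<open>H0\<close> is the flat
      in \<open>H0\<close> of the traces of the other letters.\<close>
    have flat: "flat UNIV ([H0] @ w) = flat H0 (map R w)" for w
      by (auto simp: flat_def)
    have "restr (\<lambda>w. flat UNIV w = X) (lmul [H0] q - p) \<in> I"
      using * by (intro restr_flat_I) auto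
    then have "restr (\<lambda>w. flat H0 (map R w) = X) q \<in> K"
      using * by (intro KI[of _ "restr (\<lambda>w. flat UNIV w = X) p"])
        (auto intro: restr_wspan simp only: fsp.linear_diff[OF linear_restr] restr_lmul[OF q] flat)
    then show ?thesis using * restr_lmap[OF q, of "\<lambda>w. flat H0 w = X" R] by auto
  qed
  show "x [] = 0"
  proof -
    have "q \<in> wspan (UNIV - {[]})" using q K_const[OF *(2)] by (auto simp: wspan_iff)
    then have "x \<in> wspan (map R ` (UNIV - {[]}))" using * lmap_wspan by blast
    then show ?thesis by (auto simp: wspan_iff)
  qed
next
  fix h w w' assume "w \<in> lists A''" "w' \<in> lists A''" "h \<in> set w" "flat H0 w = flat H0 w'"
  then show "lin_dependent H0 (h # w')"
    using subspace_lin_hyperplane[OF hyperplane[OF H0]]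
    by (intro lin_dependent_overfull[of H0 w' h w]) (auto intro: cut_A'')
qed

text \<open>Exactness in the middle. For the converse, a section of \<open>R\<close> carries
  \<open>I''\<close> into \<open>K\<close>, since the relations lift and \<open>K\<close> is an
  ideal. Restricting and lifting back changes an element only within \<open>K\<close>.\<close>

lemma K_iff:
  assumes "q \<in> T'"
  shows "q \<in> K \<longleftrightarrow> lmap R q \<in> I''"
proof
  show "q \<in> K \<Longrightarrow> lmap R q \<in> I''" using lmap_K_subset by auto
next
  assume q: "lmap R q \<in> I''"
  \<comment> \<open>\<open>R\<close> may identify members of \<open>A'\<close>, so one hyperplane is
    picked for each trace; \<open>word_diff_in_K\<close> absorbs the choice.\<close>
  define s where "s = inv_into A' R"
  have s: "s X \<in> A'" "R (s X) = X" if "X \<in> A''" for X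
    using that inv_into_into[of X R A'] f_inv_into_f[of X R A'] by (auto simp: s_def A''_eq)
  have map_s: "map s u \<in> lists A'" if "u \<in> lists A''" for u
    using that s(1) by (induction u) (simp_all del: Diff_iff)
  have "lmap s f \<in> K" if "f \<in> I''" for f
  proof (rule linear_ideal_into[OF linear_lmap subspace_K _ that])
    fix u v and r :: "('k ^ 'n) set list \<Rightarrow> 'k"
    assume *: "u \<in> lists A''" "v \<in> lists A''" "r \<in> OS_relations (lin_dependent H0) A''"
    have "lmap s r \<in> K"
      using *(3)
    proof (cases rule: OS_relationsE)
      case (square X)
      then show ?thesis
        using s(1) by (simp add: subsetD[OF I'_subset_K] relation_in_ideal square_relation del: Diff_iff)
    next
      case (anti X Y)
      then show ?thesis
        using s(1)
        by (simp add: lmap_add subsetD[OF I'_subset_K] relation_in_ideal anti_relation del: Diff_iff)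
    next
      case (bdry hs)
      have "map R (map s hs) = hs" using bdry(1) s(2) by (induction hs) simp_all
      then have "lin_dependent UNIV (H0 # map s hs)"
        using bdry lin_dependent_restriction[of "map s hs"] by simp
      then show ?thesis using bdry map_s by (simp add: lmap_bdry bdry_in_K del: in_lists_conv_set)
    qed
    moreover have "lmap s (lmul u (rmul r v)) = lmul (map s u) (rmul (lmap s r) (map s v))"
      using gen_wspan_UNIV[OF *(3), of "[]"] T_UNIV[OF relation_wspan[OF *(3)]]
      by (simp add: lmap_lmul lmap_rmul)
    ultimately show "lmap s (lmul u (rmul r v)) \<in> K"
      using * map_s by (simp add: lmul_K rmul_K)
  qed
  then have 1: "lmap s (lmap R q) \<in> K" using q by blast
  have "lmap s (lmap R q) - q \<in> K"
  proof (rule linear_wspan_into[OF linear_minus[OF linear_compose[OF linear_lmap linear_lmap] linear_id]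
        subspace_K _ assms])
    fix w assume w: "w \<in> lists A'"
    then have "map R w \<in> lists A''" by (auto simp: A''_eq)
    moreover from this have "map R (map s (map R w)) = map R w"
      using s(2) by (induction w) simp_all
    ultimately have "map R (map s (map R w)) = map R w" "map s (map R w) \<in> lists A'"
      using map_s by blast+
    then have "word (map s (map R w)) - word w \<in> K"
      using w by (intro word_diff_in_K) auto
    then show "lmap s (lmap R (word w)) - word w \<in> K" by simp
  qed
  from fs.subspace_diff[OF subspace_K 1 this] show "q \<in> K" by simp
qed

end

section \<open>Bases modulo the ideal\<close>

text \<open>The classes of the words in \<open>M\<close> form a basis of \<open>wspan L\<close>
  modulo \<open>J\<close>. Speaking of a set of words removes the choice functions from the
  algebra.\<close>

definition word_basis :: "'h list set \<Rightarrow> ('h list \<Rightarrow> 'k::field) set \<Rightarrow> 'h list set \<Rightarrow> bool" where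
  "word_basis L J M \<longleftrightarrow>
     (\<forall>w\<in>L. \<exists>m\<in>wspan M. word w - m \<in> J) \<and> (\<forall>m\<in>wspan M. m \<in> J \<longrightarrow> m = 0)"

lemma mem_sums_iff:
  fixes x :: "'a::ab_group_add"
  shows "(\<exists>m\<in>S. x - m \<in> J) \<longleftrightarrow> x \<in> {m + j |m j. m \<in> S \<and> j \<in> J}"
proof
  assume "\<exists>m\<in>S. x - m \<in> J"
  then obtain m where "m \<in> S" "x - m \<in> J" by blast
  moreover have "x = m + (x - m)" by simp
  ultimately show "x \<in> {m + j |m j. m \<in> S \<and> j \<in> J}" by blast
next
  assume "x \<in> {m + j |m j. m \<in> S \<and> j \<in> J}"
  then obtain m j where "m \<in> S" "j \<in> J" "x = m + j" by blast
  then show "\<exists>m\<in>S. x - m \<in> J" by (intro bexI[of _ m]) auto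
qed

lemma word_basis_span:
  assumes "word_basis L J M" "fs.subspace J" "x \<in> wspan L"
  obtains m where "m \<in> wspan M" "x - m \<in> J"
proof -
  have eq: "{x. \<exists>m\<in>wspan M. x - m \<in> J} = {m + j |m j. m \<in> wspan M \<and> j \<in> J}"
    unfolding mem_sums_iff by blast
  have "fs.subspace {x. \<exists>m\<in>wspan M. x - m \<in> J}"
    unfolding eq using assms(2) by (intro fs.subspace_sums) auto
  then have "x \<in> {x. \<exists>m\<in>wspan M. x - m \<in> J}"
    by (rule linear_wspan_into[OF linear_id _ _ assms(3)])
       (use assms(1) in \<open>auto simp: word_basis_def\<close>)
  then show ?thesis using that by auto
qed

lemma word_basis_indep: "word_basis L J M \<Longrightarrow> m \<in> wspan M \<Longrightarrow> m \<in> J \<Longrightarrow> m = 0"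
  by (simp add: word_basis_def)

lemma word_basisI:
  assumes "\<And>x. x \<in> wspan L \<Longrightarrow> \<exists>m\<in>wspan M. x - m \<in> J"
    "\<And>m. m \<in> wspan M \<Longrightarrow> m \<in> J \<Longrightarrow> m = 0"
  shows "word_basis L J M"
  using assms by (simp add: word_basis_def)

lemma wspan_Un: "wspan (L \<union> L') = {x + y |x y. x \<in> wspan L \<and> y \<in> wspan L'}"
  by (simp add: wspan_def image_Un fs.span_Un)

lemma lmul_wspan_image: "lmul u ` wspan L = wspan ((@) u ` L)"
  by (simp add: wspan_def fsp.linear_span_image[OF linear_lmul, symmetric] image_image)

lemma lmap_wspan_image: "lmap f ` wspan L = wspan (map f ` L)"
  by (simp add: wspan_def fsp.linear_span_image[OF linear_lmap, symmetric] image_image)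

text \<open>Substituting back along \<open>inv_into\<close> gives a linear left inverse
  \<open>G\<close> on \<open>wspan L\<close>.\<close>

lemma lmap_eq_0:
  fixes q :: "'a list \<Rightarrow> 'k::field"
  assumes inj: "inj_on (map f) L" and q: "q \<in> wspan L" and 0: "lmap f q = 0"
  shows "q = 0"
proof -
  define G where "G = lin_ext (\<lambda>w. word (inv_into L (map f) w) ::  _ \<Rightarrow> 'k)"
  have G: "flinear G" unfolding G_def by (rule linear_lin_ext)
  have "G (lmap f q) = q"
    by (rule linear_eq_on_wspan[OF linear_compose[OF G linear_lmap] linear_id _ q])
       (simp add: G_def inv_into_f_f[OF inj])
  then show ?thesis using 0 fsp.linear_0[OF G] by simp
qed

section \<open>Transfer of bases along deletion and restriction\<close>

context arrangement_triple
begin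

context
  fixes M' M2 M
  assumes M': "M' \<subseteq> lists A'" and M2: "M2 \<subseteq> lists A'" and inj: "inj_on (map R) M2"
    and M: "M = M' \<union> (#) H0 ` M2"
begin

lemma wspan_M:
  "(wspan M :: (('k ^ 'n) set list \<Rightarrow> 'k) set) = {x + lmul [H0] y |x y. x \<in> wspan M' \<and> y \<in> wspan M2}"
proof -
  have "(wspan ((#) H0 ` M2) :: (('k ^ 'n) set list \<Rightarrow> 'k) set) = lmul [H0] ` wspan M2"
    by (simp add: lmul_wspan_image)
  then show ?thesis
    unfolding M wspan_Un by (intro set_eqI) (simp only: mem_Collect_eq image_iff, blast)
qed

lemma wspan_M_decomposition:
  fixes m :: "('k ^ 'n) set list \<Rightarrow> 'k"
  assumes "m \<in> wspan M"
  obtains m' m2 where "m' \<in> wspan M'" "m2 \<in> wspan M2" "m = m' + lmul [H0] m2"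
  using assms that unfolding wspan_M by blast

lemma wspan_M_I:
  fixes m2 :: "('k ^ 'n) set list \<Rightarrow> 'k"
  shows "m' \<in> wspan M' \<Longrightarrow> m2 \<in> wspan M2 \<Longrightarrow> m' + lmul [H0] m2 \<in> wspan M"
  unfolding wspan_M by blast

lemma M'_T': "m \<in> wspan M' \<Longrightarrow> m \<in> T'"
  using wspan_mono[OF M'] by auto

lemma M2_T': "m \<in> wspan M2 \<Longrightarrow> m \<in> T'"
  using wspan_mono[OF M2] by auto

text \<open>Words of \<open>M'\<close> avoid \<open>H0\<close>, whereas all words of the second
  summand begin with it.\<close>

lemma decomposition_unique:
  fixes m2 :: "('k ^ 'n) set list \<Rightarrow> 'k"
  assumes "m' \<in> wspan M'" "m2 \<in> wspan M2" "m' + lmul [H0] m2 = 0"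
  shows "m' = 0" "m2 = 0"
proof -
  have "m2 w = 0" for w
  proof -
    have "m' (H0 # w) = 0" using M'_T'[OF assms(1)] by (auto simp: wspan_iff)
    then show ?thesis using fun_cong[OF assms(3), of "H0 # w"] lmul_append[of "[H0]" m2 w]
      by (simp add: pointwise)
  qed
  then show "m2 = 0" by (simp add: pointwise)
  then show "m' = 0" using assms(3) by simp
qed

lemma lmap_R_I'': "m2 \<in> wspan M2 \<Longrightarrow> lmap R m2 \<in> wspan (map R ` M2)"
  using lmap_wspan by blast

lemma T''E:
  assumes "x \<in> T''"
  obtains q where "q \<in> T'" "x = lmap R q"
proof -
  have "lists A'' = map R ` lists A'"
    unfolding A''_eq by (rule lists_image)
  then have "x \<in> lmap R ` T'" using assms by (simp only: lmap_wspan_image)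
  then show ?thesis using that by blast
qed

lemma I'_iff: "f \<in> T' \<Longrightarrow> f \<in> I' \<longleftrightarrow> f \<in> I"
  using I_Int_T' by auto

text \<open>Spanning: expand e_H0 q for a lift \<open>q\<close> and restrict the second component.
  Independence: a combination \<open>m2\<close> restricting into \<open>I''\<close> lies in
  \<open>K\<close>, so e_H0 m2 equals an element of A(A'), and expanding that in \<open>M'\<close>
  gives a relation among words of \<open>M\<close>.\<close>

lemma restriction_basis:
  assumes b: "word_basis (lists A) I M" and b': "word_basis (lists A') I' M'"
  shows "word_basis (lists A'') I'' (map R ` M2)"
proof (rule word_basisI)
  fix x assume "x \<in> T''"
  then obtain q where q: "q \<in> T'" "x = lmap R q" by (rule T''E)
  have "lmul [H0] q \<in> T"
    using q(1) H0 wspan_mono[of "lists A'" "lists A"] by (auto intro!: lmul_wspan)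
  then obtain m where m: "m \<in> wspan M" "lmul [H0] q - m \<in> I"
    by (rule word_basis_span[OF b subspace_OS_ideal])
  from m(1) obtain m' m2 where mm: "m' \<in> wspan M'" "m2 \<in> wspan M2" "m = m' + lmul [H0] m2"
    by (rule wspan_M_decomposition)
  have "lmul [H0] (q - m2) - m' \<in> I" using m(2) mm(3) by (simp add: lmul_diff algebra_simps)
  moreover have "q - m2 \<in> T'" using q mm M2_T' by (auto intro: fs.subspace_diff)
  ultimately have "lmap R (q - m2) \<in> I''"
    using KI[of "q - m2" m'] K_iff[of "q - m2"] M'_T'[OF mm(1)] by blast
  then show "\<exists>m\<in>wspan (map R ` M2). x - m \<in> I''"
    using q(2) lmap_R_I''[OF mm(2)] by (auto simp: lmap_diff)
next
  fix f assume f: "f \<in> wspan (map R ` M2)" "f \<in> I''"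
  then obtain m2 where m2: "m2 \<in> wspan M2" "f = lmap R m2"
    unfolding lmap_wspan_image[symmetric] by auto
  have "m2 \<in> K" using K_iff[OF M2_T'[OF m2(1)]] f(2) m2(2) by simp
  then obtain p where p: "p \<in> T'" "lmul [H0] m2 - p \<in> I" by (rule KE)
  obtain m' where m': "m' \<in> wspan M'" "p - m' \<in> I'"
    using p(1) by (rule word_basis_span[OF b' subspace_OS_ideal])
  have "p - m' \<in> I" using m'(2) I_Int_T' by auto
  then have "(lmul [H0] m2 - p) + (p - m') \<in> I" using p(2) by (intro fs.subspace_add) auto
  then have I: "- m' + lmul [H0] m2 \<in> I" by simp
  have m'n: "- m' \<in> wspan M'" using m' by (auto intro: fs.subspace_neg)
  have "- m' + lmul [H0] m2 = 0"
    using word_basis_indep[OF b wspan_M_I[OF m'n m2(1)] I] .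
  then have "m2 = 0" by (rule decomposition_unique[OF m'n m2(1)])
  then show "f = 0" by (simp add: m2(2) fsp.linear_0[OF linear_lmap])
qed

text \<open>Expanding an element of \<open>T'\<close> in \<open>M\<close> leaves a second component
  in \<open>K\<close>. Its restriction vanishes by independence in A(A''), hence so does the
  component itself.\<close>

lemma deletion_basis:
  assumes b: "word_basis (lists A) I M" and b'': "word_basis (lists A'') I'' (map R ` M2)"
  shows "word_basis (lists A') I' M'"
proof (rule word_basisI)
  fix x assume x: "x \<in> T'"
  have "x \<in> T" using x wspan_mono[of "lists A'" "lists A"] by auto
  then obtain m where m: "m \<in> wspan M" "x - m \<in> I"
    by (rule word_basis_span[OF b subspace_OS_ideal])
  from m(1) obtain m' m2 where mm: "m' \<in> wspan M'" "m2 \<in> wspan M2" "m = m' + lmul [H0] m2"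
    by (rule wspan_M_decomposition)
  have T': "x - m' \<in> T'" using x mm M'_T' by (auto intro: fs.subspace_diff)
  have "- (x - m) \<in> I" using m(2) by (intro fs.subspace_neg) auto
  then have "lmul [H0] m2 - (x - m') \<in> I" using mm(3) by (simp add: algebra_simps)
  then have "m2 \<in> K" using KI M2_T'[OF mm(2)] T' by blast
  then have "lmap R m2 \<in> I''" using K_iff[OF M2_T'[OF mm(2)]] by blast
  then have "lmap R m2 = 0" using word_basis_indep[OF b'' lmap_R_I''[OF mm(2)]] by blast
  then have "m2 = 0" by (rule lmap_eq_0[OF inj mm(2)])
  then have "x - m' \<in> I" using m(2) mm(3) by simp
  then show "\<exists>m\<in>wspan M'. x - m \<in> I'" using I'_iff[OF T'] mm(1) by blast
next
  fix m assume m: "m \<in> wspan M'" "m \<in> I'"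
  have "m \<in> wspan M" using m(1) wspan_mono[of M' M] M by auto
  moreover have "m \<in> I" using m(2) I_Int_T' by auto
  ultimately show "m = 0" by (rule word_basis_indep[OF b])
qed

text \<open>Spanning: write x = p + e_H0 q, expand the restriction of \<open>q\<close>, and move the
  remaining error, which lies in \<open>K\<close>, into A(A'). Independence: restrict first, then
  use independence in A(A').\<close>

lemma arrangement_basis:
  assumes b': "word_basis (lists A') I' M'" and b'': "word_basis (lists A'') I'' (map R ` M2)"
  shows "word_basis (lists A) I M"
proof (rule word_basisI)
  fix x assume "x \<in> T"
  then obtain p q where pq: "p \<in> T'" "q \<in> T'" "x - p - lmul [H0] q \<in> I"
    by (rule T_decomposition)
  have "lmap R q \<in> T''"
    unfolding A''_eq lists_image using pq(2) by (rule lmap_wspan)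
  then obtain f where f: "f \<in> wspan (map R ` M2)" "lmap R q - f \<in> I''"
    by (rule word_basis_span[OF b'' subspace_OS_ideal])
  then obtain m2 where m2: "m2 \<in> wspan M2" "f = lmap R m2"
    unfolding lmap_wspan_image[symmetric] by auto
  have "q - m2 \<in> T'" using pq M2_T'[OF m2(1)] by (auto intro: fs.subspace_diff)
  then have "q - m2 \<in> K" using f(2) m2(2) K_iff[of "q - m2"] by (simp add: lmap_diff)
  then obtain p2 where p2: "p2 \<in> T'" "lmul [H0] (q - m2) - p2 \<in> I" by (rule KE)
  have "p + p2 \<in> T'" using pq p2 by (auto intro: fs.subspace_add)
  then obtain m' where m': "m' \<in> wspan M'" "p + p2 - m' \<in> I'"
    by (rule word_basis_span[OF b' subspace_OS_ideal])
  have "x - (m' + lmul [H0] m2)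
      = (x - p - lmul [H0] q) + (lmul [H0] (q - m2) - p2) + (p + p2 - m')"
    by (simp add: lmul_diff)
  also have "\<dots> \<in> I" using pq p2 m' I_Int_T' by (intro fs.subspace_add) auto
  finally show "\<exists>m\<in>wspan M. x - m \<in> I" using wspan_M_I[OF m'(1) m2(1)] by blast
next
  fix m assume m: "m \<in> wspan M" "m \<in> I"
  from m(1) obtain m' m2 where mm: "m' \<in> wspan M'" "m2 \<in> wspan M2" "m = m' + lmul [H0] m2"
    by (rule wspan_M_decomposition)
  have "- m' \<in> T'" using M'_T'[OF mm(1)] by (auto intro: fs.subspace_neg)
  moreover have "lmul [H0] m2 - (- m') \<in> I" using m(2) mm(3) by (simp add: add.commute)
  ultimately have "m2 \<in> K" using KI M2_T'[OF mm(2)] by blast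
  then have "lmap R m2 \<in> I''" using K_iff[OF M2_T'[OF mm(2)]] by blast
  then have "lmap R m2 = 0" using word_basis_indep[OF b'' lmap_R_I''[OF mm(2)]] by blast
  then have "m2 = 0" by (rule lmap_eq_0[OF inj mm(2)])
  then have "m = m'" using mm(3) by simp
  moreover have "m' \<in> I'" using I'_iff[OF M'_T'[OF mm(1)]] m(2) \<open>m = m'\<close> by simp
  ultimately show "m = 0" using word_basis_indep[OF b' mm(1)] by simp
qed

end

end

section \<open>Block words\<close>

text \<open>The words with at most one letter from each block, in block order, given recursively for
  induction over the blocks.\<close>

fun block_words :: "'h set list \<Rightarrow> 'h list set" where
  "block_words [] = {[]}"
| "block_words (X # \<sigma>) = block_words \<sigma> \<union> (\<Union>h\<in>X. (#) h ` block_words \<sigma>)"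

lemma block_words_subset: "block_words \<sigma> \<subseteq> lists (\<Union>(set \<sigma>))"
  by (induction \<sigma>) fastforce+

lemma choice_word_Suc:
  "choice_word (Suc t) ch = (case ch 0 of None \<Rightarrow> [] | Some H \<Rightarrow> [H]) @ choice_word t (ch \<circ> Suc)"
proof -
  have "[0..<Suc t] = 0 # map Suc [0..<t]" by (simp add: upt_conv_Cons map_Suc_upt del: upt_Suc)
  then show ?thesis by (simp add: choice_word_def comp_def del: upt_Suc)
qed

lemma choices_Cons:
  "ch \<in> choices (X # \<sigma>) \<longleftrightarrow>
    (ch 0 = None \<or> (\<exists>H\<in>X. ch 0 = Some H)) \<and> ch \<circ> Suc \<in> choices \<sigma>"
proof -
  have "(\<forall>i\<ge>Suc (length \<sigma>). ch i = None) \<longleftrightarrow> (\<forall>i\<ge>length \<sigma>. ch (Suc i) = None)"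
    by (metis Suc_le_D Suc_le_mono)
  then show ?thesis by (auto simp: choices_def All_less_Suc2)
qed

lemma choice_word_image: "choice_word (length \<sigma>) ` choices \<sigma> = block_words \<sigma>"
proof (induction \<sigma>)
  case Nil
  have "(\<lambda>_. None) \<in> choices []" by (simp add: choices_def)
  then show ?case by (auto simp: choice_word_def)
next
  case (Cons X \<sigma>)
  show ?case
  proof (intro equalityI subsetI)
    fix w assume "w \<in> choice_word (length (X # \<sigma>)) ` choices (X # \<sigma>)"
    then obtain ch where ch: "ch \<in> choices (X # \<sigma>)" "w = choice_word (length (X # \<sigma>)) ch" by auto
    have "choice_word (length \<sigma>) (ch \<circ> Suc) \<in> block_words \<sigma>"
      using ch(1) Cons.IH by (auto simp: choices_Cons)
    then show "w \<in> block_words (X # \<sigma>)"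
      using ch by (cases "ch 0") (auto simp: choices_Cons choice_word_Suc)
  next
    fix w assume "w \<in> block_words (X # \<sigma>)"
    then obtain a v where a: "a = None \<and> w = v \<or> (\<exists>H\<in>X. a = Some H \<and> w = H # v)" "v \<in> block_words \<sigma>"
      by auto
    from a(2) obtain ch where ch: "ch \<in> choices \<sigma>" "v = choice_word (length \<sigma>) ch"
      using Cons.IH by auto
    have Suc: "case_nat a ch \<circ> Suc = ch" by (auto simp: fun_eq_iff)
    have "case_nat a ch \<in> choices (X # \<sigma>)" using a ch by (auto simp: choices_Cons Suc)
    moreover have "w = choice_word (length (X # \<sigma>)) (case_nat a ch)"
      using a ch by (auto simp: choice_word_Suc Suc)
    ultimately show "w \<in> choice_word (length (X # \<sigma>)) ` choices (X # \<sigma>)" by blast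
  qed
qed

definition disjoint_blocks :: "'h set list \<Rightarrow> bool" where
  "disjoint_blocks \<sigma> \<longleftrightarrow> sorted_wrt (\<lambda>X Y. X \<inter> Y = {}) \<sigma>"

text \<open>Letters of the first block do not occur in later ones, so the head of the word reveals
  the first choice. This reconciles independence indexed by choices with independence of a set of
  words.\<close>

lemma inj_on_choice_word:
  assumes "disjoint_blocks \<sigma>"
  shows "inj_on (choice_word (length \<sigma>)) (choices \<sigma>)"
  using assms
proof (induction \<sigma>)
  case Nil
  then show ?case by (auto simp: choices_def inj_on_def fun_eq_iff)
next
  case (Cons X \<sigma>)
  show ?case
  proof (rule inj_onI)
    fix ch ch' assume ch: "ch \<in> choices (X # \<sigma>)" "ch' \<in> choices (X # \<sigma>)"
      and eq: "choice_word (length (X # \<sigma>)) ch = choice_word (length (X # \<sigma>)) ch'"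
    have tail: "choice_word (length \<sigma>) (c \<circ> Suc) \<noteq> H # v"
      if "c \<in> choices (X # \<sigma>)" "H \<in> X" for c H v
    proof -
      have "choice_word (length \<sigma>) (c \<circ> Suc) \<in> lists (\<Union>(set \<sigma>))"
        using that(1) choice_word_image[of \<sigma>] block_words_subset[of \<sigma>] by (auto simp: choices_Cons)
      moreover have "\<Union>(set \<sigma>) \<inter> X = {}" using Cons.prems by (auto simp: disjoint_blocks_def)
      ultimately have "H \<notin> set (choice_word (length \<sigma>) (c \<circ> Suc))" using that(2) by blast
      then show ?thesis by auto
    qed
    have "ch 0 = ch' 0 \<and> choice_word (length \<sigma>) (ch \<circ> Suc) = choice_word (length \<sigma>) (ch' \<circ> Suc)"
      using eq tail[OF ch(1)] tail[OF ch(2), THEN not_sym] ch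
      by (auto simp: choice_word_Suc choices_Cons split: option.splits)
    moreover from this have "ch \<circ> Suc = ch' \<circ> Suc"
      using Cons ch by (auto simp: disjoint_blocks_def choices_Cons dest: inj_onD)
    ultimately show "ch = ch'"
      by (metis comp_apply ext not0_implies_Suc)
  qed
qed

lemma finite_block_words: "\<forall>X\<in>set \<sigma>. finite X \<Longrightarrow> finite (block_words \<sigma>)"
  by (induction \<sigma>) auto

text \<open>Coefficient families on choices correspond to elements of
  \<open>wspan (block_words \<sigma>)\<close>. Finite blocks matter: a sum over infinitely many
  choices would be 0 by convention.\<close>

lemma kappa_iso_iff_word_basis:
  fixes dep :: "'h list \<Rightarrow> bool"
  assumes dis: "disjoint_blocks \<sigma>" and fin: "\<forall>X\<in>set \<sigma>. finite X"
  shows "kappa_iso dep B \<sigma> TYPE('k::field) \<longleftrightarrow>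
    word_basis (lists B) (OS_ideal dep B :: ('h list \<Rightarrow> 'k) set) (block_words \<sigma>)"
proof -
  let ?cw = "choice_word (length \<sigma>)"
  let ?I = "OS_ideal dep B :: ('h list \<Rightarrow> 'k) set"
  have inj: "inj_on ?cw (choices \<sigma>)" using dis by (rule inj_on_choice_word)
  have fin_ch: "finite (choices \<sigma>)"
    using finite_imageD[OF _ inj] finite_block_words[OF fin] by (simp add: choice_word_image)
  have "(\<lambda>ch. word (?cw ch) :: 'h list \<Rightarrow> 'k) ` choices \<sigma> = word ` block_words \<sigma>"
    by (simp add: choice_word_image[symmetric] image_image)
  then have span: "fspan ((\<lambda>ch. word (?cw ch) :: 'h list \<Rightarrow> 'k) ` choices \<sigma> \<union> OS_ideal_gens dep B)
      = {x + y |x y. x \<in> wspan (block_words \<sigma>) \<and> y \<in> ?I}"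
    by (simp add: fspan_eq_span fs.span_Un wspan_def OS_ideal_def)
  have 1: "x \<in> fspan ((\<lambda>ch. word (?cw ch)) ` choices \<sigma> \<union> OS_ideal_gens dep B)
      \<longleftrightarrow> (\<exists>m\<in>wspan (block_words \<sigma>). x - m \<in> ?I)" for x
    unfolding span mem_sums_iff ..
  define comb where "comb c = (\<lambda>w. \<Sum>ch\<in>choices \<sigma>. c ch * word (?cw ch) w)" for c :: "_ \<Rightarrow> 'k"
  have comb_apply: "comb c (?cw ch) = c ch" if "ch \<in> choices \<sigma>" for c ch
  proof -
    have "comb c (?cw ch) = (\<Sum>ch'\<in>choices \<sigma>. if ch' = ch then c ch else 0)"
      unfolding comb_def using inj that by (intro sum.cong) (auto simp: word_apply dest: inj_onD)
    then show ?thesis using fin_ch that by simp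
  qed
  have comb_wspan: "comb c \<in> wspan (block_words \<sigma>)" for c
  proof -
    have "comb c = (\<Sum>ch\<in>choices \<sigma>. fscale (c ch) (word (?cw ch)))"
      by (simp add: comb_def pointwise)
    then show ?thesis
      using choice_word_image[of \<sigma>] by (auto intro!: fs.subspace_sum fs.subspace_scale)
  qed
  have comb_zero: "comb c = 0 \<longleftrightarrow> (\<forall>ch\<in>choices \<sigma>. c ch = 0)" for c
  proof
    assume "comb c = 0"
    then show "\<forall>ch\<in>choices \<sigma>. c ch = 0" using comb_apply[of _ c] by (auto simp: pointwise)
  qed (simp add: comb_def pointwise)
  have wspan_comb: "f \<in> range comb" if "f \<in> wspan (block_words \<sigma>)" for f
  proof -
    have "comb (f \<circ> ?cw) = f"
    proof
      fix w
      show "comb (f \<circ> ?cw) w = f w"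
      proof (cases "w \<in> block_words \<sigma>")
        case True
        then obtain ch where "ch \<in> choices \<sigma>" "w = ?cw ch" using choice_word_image[of \<sigma>] by auto
        then show ?thesis using comb_apply by simp
      next
        case False
        then have "comb (f \<circ> ?cw) w = 0" "f w = 0"
          using comb_wspan[of "f \<circ> ?cw"] that unfolding wspan_iff by blast+
        then show ?thesis by simp
      qed
    qed
    then show ?thesis by (metis rangeI)
  qed
  have "wspan (block_words \<sigma>) = range comb" using comb_wspan wspan_comb by blast
  then have "(\<forall>m\<in>wspan (block_words \<sigma>). m \<in> ?I \<longrightarrow> m = 0) \<longleftrightarrow>
      (\<forall>c. comb c \<in> ?I \<longrightarrow> (\<forall>ch\<in>choices \<sigma>. c ch = 0))"
    by (simp add: comb_zero)
  moreover have "fspan (OS_ideal_gens dep B) = ?I" by (simp add: fspan_eq_span OS_ideal_def)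
  ultimately show ?thesis
    unfolding kappa_iso_def word_basis_def 1 comb_def by simp
qed

text \<open>An empty block contributes only the factor 1. This handles a first block equal to
  \<open>{H0}\<close>, which disappears on deletion.\<close>

lemma block_words_filter: "block_words (filter (\<lambda>X. X \<noteq> {}) \<sigma>) = block_words \<sigma>"
  by (induction \<sigma>) auto

lemma block_words_map: "block_words (map ((`) f) \<sigma>) = map f ` block_words \<sigma>"
  by (induction \<sigma>) (auto simp: image_Un image_UN image_image)

section \<open>The three implications for the induced partitions\<close>

theorem theorem1p1:
  fixes A :: "('k::field ^ 'n) set set"
    and \<pi> :: "('k ^ 'n) set set list"
    and H0 :: "('k ^ 'n) set"
  assumes "central_arrangement A"
    and "A \<noteq> {}"
    and "is_partition A \<pi>"
    and "H0 \<in> \<pi> ! 0"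
    and "bij_betw (\<lambda>H. H \<inter> H0) (A - \<pi> ! 0) (restr_arr A H0)"
  defines "i \<equiv> kappa_iso (lin_dependent UNIV) A \<pi> TYPE('k)"
    and "ii \<equiv> kappa_iso (lin_dependent UNIV) (A - {H0}) (deletion_partition \<pi> H0) TYPE('k)"
    and "iii \<equiv> kappa_iso (lin_dependent H0) (restr_arr A H0) (restriction_partition \<pi> H0) TYPE('k)"
  shows "(i \<and> ii \<longrightarrow> iii) \<and> (i \<and> iii \<longrightarrow> ii) \<and> (ii \<and> iii \<longrightarrow> i)"
proof -
  let ?R = "\<lambda>H. H \<inter> H0"
  have union: "\<Union>(set \<pi>) = A" using assms(3) by (simp add: is_partition_def)
  then obtain P \<tau> where \<pi>: "\<pi> = P # \<tau>" using assms(2) by (cases \<pi>) auto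
  have dis: "disjoint_blocks \<pi>"
    using assms(3) by (auto simp: disjoint_blocks_def sorted_wrt_iff_nth_less is_partition_def)
  have H0P: "H0 \<in> P" using assms(4) \<pi> by simp
  have H0: "H0 \<in> A" using H0P union \<pi> by auto
  have finA: "finite A" using assms(1) by (simp add: central_arrangement_def)
  have fin: "\<forall>X\<in>set \<pi>. finite X" using finA union by (meson Union_upper finite_subset)
  have H0\<tau>: "H0 \<notin> X" if "X \<in> set \<tau>" for X
    using dis that H0P \<pi> by (auto simp: disjoint_blocks_def)
  have \<tau>: "\<Union>(set \<tau>) = A - P"
    using dis union \<pi> by (fastforce simp: disjoint_blocks_def)
  have inj: "inj_on ?R (A - P)" using assms(5) \<pi> by (auto simp: bij_betw_def)
  interpret arrangement_triple A H0
    using assms(1) H0 by unfold_locales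

  have del: "map (\<lambda>X. X - {H0}) \<tau> = \<tau>" using H0\<tau> by (intro map_idI) auto
  have M': "block_words (deletion_partition \<pi> H0) = block_words ((P - {H0}) # \<tau>)"
    unfolding deletion_partition_def block_words_filter by (simp add: \<pi> del)
  have M'': "block_words (restriction_partition \<pi> H0) = map ?R ` block_words \<tau>"
    by (simp add: restriction_partition_def \<pi> block_words_map)
  \<comment> \<open>The words are split by whether the letter chosen from the first block is
    \<open>H0\<close>; this is the shape required for the transfer of bases.\<close>
  have M: "block_words \<pi> = block_words (deletion_partition \<pi> H0) \<union> (#) H0 ` block_words \<tau>"
    unfolding M' unfolding \<pi> using H0P by auto
  have "\<Union>(set ((P - {H0}) # \<tau>)) \<subseteq> A - {H0}" using H0\<tau> union \<pi> by auto
  from order_trans[OF block_words_subset lists_mono[OF this]]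
  have sub': "block_words (deletion_partition \<pi> H0) \<subseteq> lists (A - {H0})"
    unfolding M' .
  have "\<Union>(set \<tau>) \<subseteq> A - {H0}" using H0\<tau> union \<pi> by auto
  from order_trans[OF block_words_subset lists_mono[OF this]]
  have sub2: "block_words \<tau> \<subseteq> lists (A - {H0})" .
  \<comment> \<open>Here injectivity of the restriction keeps lifted words distinct; below it keeps
    the restricted blocks disjoint.\<close>
  have inj2: "inj_on (map ?R) (block_words \<tau>)"
  proof (rule inj_on_subset[of _ "lists (A - P)"])
    show "inj_on (map ?R) (lists (A - P))"
      by (rule inj_on_mapI) (use inj in \<open>auto intro: inj_on_subset\<close>)
    show "block_words \<tau> \<subseteq> lists (A - P)" using block_words_subset[of \<tau>] \<tau> by simp
  qed
  have dis': "disjoint_blocks (deletion_partition \<pi> H0)"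
    using dis unfolding disjoint_blocks_def deletion_partition_def
    by (intro sorted_wrt_filter) (auto simp: sorted_wrt_map intro: sorted_wrt_mono_rel[rotated])
  have dis'': "disjoint_blocks (restriction_partition \<pi> H0)"
  proof -
    have "sorted_wrt (\<lambda>X Y. X \<inter> Y = {}) \<tau>" using dis \<pi> by (simp add: disjoint_blocks_def)
    then have "sorted_wrt (\<lambda>X Y. ?R ` X \<inter> ?R ` Y = {}) \<tau>"
    proof (rule sorted_wrt_mono_rel[rotated])
      fix X Y assume XY: "X \<in> set \<tau>" "Y \<in> set \<tau>" "X \<inter> Y = {}"
      then have "X \<subseteq> A - P" "Y \<subseteq> A - P" using \<tau> by auto
      then have "?R ` X \<inter> ?R ` Y = ?R ` (X \<inter> Y)" by (rule inj_on_image_Int[OF inj, symmetric])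
      then show "?R ` X \<inter> ?R ` Y = {}" using XY by simp
    qed
    then show ?thesis by (simp add: disjoint_blocks_def restriction_partition_def \<pi> sorted_wrt_map)
  qed
  have fin': "\<forall>X\<in>set (deletion_partition \<pi> H0). finite X"
    and fin'': "\<forall>X\<in>set (restriction_partition \<pi> H0). finite X"
    using fin \<pi> by (auto simp: deletion_partition_def restriction_partition_def)
  have i: "i \<longleftrightarrow> word_basis (lists A) I (block_words \<pi>)"
    unfolding i_def by (rule kappa_iso_iff_word_basis[OF dis fin])
  have ii: "ii \<longleftrightarrow> word_basis (lists (A - {H0})) I' (block_words (deletion_partition \<pi> H0))"
    unfolding ii_def by (rule kappa_iso_iff_word_basis[OF dis' fin'])
  have iii: "iii \<longleftrightarrow> word_basis (lists (restr_arr A H0)) I'' (map ?R ` block_words \<tau>)"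
    unfolding iii_def M''[symmetric] by (rule kappa_iso_iff_word_basis[OF dis'' fin''])
  show ?thesis
    unfolding i ii iii
    using restriction_basis[OF sub' sub2 inj2 M] deletion_basis[OF sub' sub2 inj2 M]
      arrangement_basis[OF sub' sub2 inj2 M] by blast
qed

end
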